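(* Let $\mathsf{HF}$ be a universal $(\omega,\delta)$-partially lossy hierarchical identity-based trapdoor function with input space $\{0,1\}^n$ (with associated sibling $\mathsf{LHF}$ and pre-output stage $\mathcal{P}$). Then the hierarchical identity-based deterministic encryption scheme $\mathsf{HIB\text{-}DE}$ defined by $\mathsf{HF}$ is PRIV1-IND-ID secure for polynomial-time sampleable $(t,s)$-sources (with $s=n$) such that $t\ge n-\omega+2\log(1/\epsilon)$ for some negligible $\epsilon$. In particular, for any two such $(t,s)$-sources $M_0$ and $M_1$ and for every PPT PRIV1-IND-ID adversary $\mathcal{B}$ against $\mathsf{HIB\text{-}DE}$ there exist a PPT adversary $\mathcal{A}$ against $\mathsf{HF}$, a parameter $\zeta\in(0,1)$ and a negligible function $\nu$ such that $$\mathbf{Adv}^{\mathrm{lossy}}_{\mathsf{HF},\mathsf{LHF},\mathcal{P},\omega,\zeta}(\mathcal{A})\ \ge\ \frac13\cdot\delta\cdot\mathbf{Adv}^{\mathrm{priv1\text{-}ind\text{-}id}}_{\mathsf{HIB\text{-}DE}}(\mathcal{B},M_0,M_1)-\nu(\varrho).$$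
   Context: Throughout, $\varrho$ is the security parameter. **HIB-TDF syntax.** A HIB-TDF is a tuple of efficient algorithms $\mathsf{HF}=(\mathsf{HF.Setup},\mathsf{HF.MKg},\mathsf{HF.Kg},\mathsf{HF.Del},\mathsf{HF.Eval},\mathsf{HF.Inv})$. $\mathsf{HF.Setup}$ takes $\varrho$, the (constant) number $d$ of hierarchy levels, the identity length $\mu$ and input length $n$ and outputs $\mathsf{pms}$, specifying an input space $\mathsf{InpSp}$ and an identity space $\mathsf{IdSp}$ of hierarchical identities $(\mathsf{id}_1,\dots,\mathsf{id}_\ell)$, $1\le\ell\le d$. $\mathsf{HF.MKg}(\mathsf{pms})$ outputs $(\mathsf{mpk},\mathsf{msk})$. $\mathsf{HF.Kg}(\mathsf{pms},\mathsf{msk},\mathsf{id})$ outputs $SK_{\mathsf{id}}$. $\mathsf{HF.Del}$ derives from $SK_{\mathsf{id}}$ and $\mathsf{id}_{\ell+1}$ a key for $(\mathsf{id},\mathsf{id}_{\ell+1})$. $\mathsf{HF.Eval}(\mathsf{pms},\mathsf{mpk},\mathsf{id},X)$ (deterministic) evaluates the function at $X\in\mathsf{InpSp}$ and $\mathsf{HF.Inv}(\mathsf{pms},\mathsf{mpk},\mathsf{id},SK_{\mathsf{id}},C)$ inverts it. Correctness: inversion with any (generated or delegated) key recovers $X$. A *sibling* of $\mathsf{HF}$ is a tuple $\mathsf{LHF}=(\mathsf{HF.Setup},\mathsf{LHF.MKg},\mathsf{LHF.Kg},\mathsf{HF.Del},\mathsf{HF.Eval},\mathsf{HF.Inv})$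 of the same kind where $\mathsf{pms}$ specifies an auxiliary input space $\mathsf{AuxSp}\supset\mathsf{IdSp}$ and $\mathsf{LHF.MKg}$ takes an additional input $aux\in\mathsf{AuxSp}$. The lossiness of a function $f$ is $\lambda(f)=\log_2(|\mathrm{Dom}(f)|/|\mathrm{Im}(f)|)$. $\mathsf{id}\le\mathsf{id}'$ means that $\mathsf{id}$ is a prefix of $\mathsf{id}'$. **Experiments.** Let $\mathcal{P}$ (pre-output stage) be a PPT algorithm which on input $\zeta,\mathsf{pms},\mathsf{mpk}_1,\mathsf{msk}_1,IS,\mathsf{id}^\star$ outputs a bit $d_2$. For an adversary $\mathcal{A}$ and $\zeta\in(0,1)$, $\mathsf{REAL}$ ($\beta=0$) and $\mathsf{LOSSY}$ ($\beta=1$) are as follows. 0. The challenger runs $\mathsf{HF.Setup}$, gives $\mathsf{pms}$ to $\mathcal{A}$, who replies with $\mathsf{id}^\dagger$. 1. The challenger runs (in both experiments) $(\mathsf{mpk}_0,\mathsf{msk}_0)\leftarrow\mathsf{HF.MKg}(\mathsf{pms})$ and $(\mathsf{mpk}_1,\mathsf{msk}_1)\leftarrow\mathsf{LHF.MKg}(\mathsf{pms},aux=\mathsf{id}^\dagger)$, gives $\mathsf{mpk}_\beta$ to $\mathcal{A}$, sets $IS=QS=\emptyset$. 2. Adaptive queries: *Create-key*($\mathsf{id}$) creates $SK_{\mathsf{id}}$ with $\mathsf{HF.Kg}$ and $\mathsf{msk}_0$ if $\beta=0$, with $\mathsf{LHF.Kg}$ and $\mathsf{msk}_1$ if $\beta=1$,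 and adds $\mathsf{id}$ to $QS$; *Create-delegated-key*($\mathsf{id},\mathsf{id}_{\ell+1}$), $\mathsf{id}\in QS$, creates a key for $(\mathsf{id},\mathsf{id}_{\ell+1})$ with $\mathsf{HF.Del}$ and adds it to $QS$; *Reveal-key*($\mathsf{id}$) (with $\mathsf{id}\not\le\mathsf{id}^\dagger$ if $\mathcal{A}$ is selective) returns $\perp$ if $\mathsf{id}\notin QS$, else returns $SK_{\mathsf{id}}$ and adds $\mathsf{id}$ to $IS$. 3. $\mathcal{A}$ outputs $\mathsf{id}^\star$ and a bit $d_{\mathcal{A}}$; in the selective case $\mathsf{id}^\star=\mathsf{id}^\dagger$; in the adaptive case no element of $IS$ is a prefix of $\mathsf{id}^\star$. Let $d_1=1$ iff $\lambda(\mathsf{HF.Eval}(\mathsf{pms},\mathsf{mpk}_1,\mathsf{id},\cdot))=0$ for all $\mathsf{id}\in IS$ and $\lambda(\mathsf{HF.Eval}(\mathsf{pms},\mathsf{mpk}_1,\mathsf{id}^\star,\cdot))\ge\omega$. 4. $d_2\leftarrow\mathcal{P}(\zeta,\mathsf{pms},\mathsf{mpk}_1,\mathsf{msk}_1,IS,\mathsf{id}^\star)$. 5. $d^{\mathcal{A}}_{\neg abort}=d_1\wedge d_2$ and $d^{\mathcal{A}}_{exp}=d_{\mathcal{A}}\wedge d^{\mathcal{A}}_{\neg abort}$. **Partial lossiness.** $\mathsf{HF}$ is $(\omega,\delta)$-partially lossy if it admits a sibling $\mathsf{LHF}$ and an efficient pre-output stage $\mathcal{P}$ such that for all PPT $\mathcal{A}$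 and all non-negligible $\zeta$ there exist non-negligible $\epsilon_1,\epsilon_2$ with $\delta=\epsilon_1\epsilon_2$ such that: (i) $\mathbf{Adv}^{\mathrm{lossy}}_{\mathsf{HF},\mathsf{LHF},\mathcal{P},\omega,\zeta}(\mathcal{A})=|\Pr[d^{\mathcal{A}}_{exp}=1\mid\mathsf{REAL}]-\Pr[d^{\mathcal{A}}_{exp}=1\mid\mathsf{LOSSY}]|$ is negligible; (ii) $\Pr[d^{\mathcal{A}}_{\neg abort}=1\mid\mathsf{REAL}]\ge\epsilon_1$; (iii) if $\Pr[d_{\mathcal{A}}=1\mid\mathsf{REAL}]-\frac12>\zeta$ then $\Pr[d_{\mathcal{A}}=1\mid\mathsf{REAL}\wedge d^{\mathcal{A}}_{\neg abort}=1]-\frac12>\epsilon_2\zeta$. ($\delta$ may depend on the maximal number of key queries.) **Universality.** $\mathsf{HF}$ is universal if $\mathsf{HF.Setup}$, $\mathsf{LHF.MKg}$ and $\mathsf{HF.Eval}(\mathsf{pms},\mathsf{mpk}_1,\mathsf{id}^\star,\cdot)$ induce a universal hash function whenever the function for $\mathsf{id}^\star$ is lossy, i.e. $\lambda(\mathsf{HF.Eval}(\mathsf{pms},\mathsf{mpk}_1,\mathsf{id}^\star,\cdot))\ge\omega$. **Deterministic HIBE defined by $\mathsf{HF}$.** $\mathsf{HIB\text{-}DE}$ has plaintext space $\{0,1\}^s$, $s=n$; its setup, master key generation, key generation, delegation, encryption and decryption algorithms are $\mathsf{HF.Setup},\mathsf{HF.MKg},\mathsf{HF.Kg},\mathsf{HF.Del},\mathsf{HF.Eval},\mathsf{HF.Inv}$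 respectively. **Security of deterministic HIBE.** A random variable $X$ over $\{0,1\}^s$ is a $(t,s)$-source if $H_\infty(X)=-\log_2\max_xP_X(x)\ge t$. For a random variable $M$, the experiment $\mathsf{Guess}^{\mathcal{B}}_{\mathsf{HIB\text{-}DE}}(M)$ is: the challenger runs setup and gives $\mathsf{pms}$ to $\mathcal{B}$, who replies with some $\mathsf{id}^\dagger$; the challenger generates $(\mathsf{mpk},\mathsf{msk})$, gives $\mathsf{mpk}$ to $\mathcal{B}$ and sets $QS=IS=\emptyset$; $\mathcal{B}$ makes adaptive queries of three kinds: *Create-key*($\mathsf{id}$), upon which the challenger creates a key $SK_{\mathsf{id}}$ with the key generation algorithm of $\mathsf{HIB\text{-}DE}$ and $\mathsf{msk}$ and adds $\mathsf{id}$ to $QS$; *Create-delegated-key*($\mathsf{id},\mathsf{id}_{\ell+1}$) with $\mathsf{id}\in QS$, upon which the challenger creates a key for $(\mathsf{id},\mathsf{id}_{\ell+1})$ from $SK_{\mathsf{id}}$ with the delegation algorithm of $\mathsf{HIB\text{-}DE}$ and adds $(\mathsf{id},\mathsf{id}_{\ell+1})$ to $QS$; and *Reveal-key*($\mathsf{id}$), upon which the challenger returns $\perp$ if $\mathsf{id}\notin QS$, and otherwise returns $SK_{\mathsf{id}}$ and adds $\mathsf{id}$ to $IS$ (revealed identities form $IS$; in the selective case they may not be prefixes of $\mathsf{id}^\dagger$); $\mathcal{B}$ outputs $\mathsf{id}^\star$ (equal to $\mathsf{id}^\dagger$ in the selective case; in the adaptive case no element of $IS$ is a prefix of $\mathsf{id}^\star$);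 the challenger samples $m$ from $M$ and sends the encryption of $m$ under $\mathsf{id}^\star$; $\mathcal{B}$ outputs a bit, the output of the experiment. The advantage is $\mathbf{Adv}^{\mathrm{priv1\text{-}ind\text{-}id}}_{\mathsf{HIB\text{-}DE}}(\mathcal{B},M_0,M_1)=\Pr[\mathsf{Guess}^{\mathcal{B}}_{\mathsf{HIB\text{-}DE}}(M_0)=1]-\Pr[\mathsf{Guess}^{\mathcal{B}}_{\mathsf{HIB\text{-}DE}}(M_1)=1]$; PRIV1-IND-ID security for a class of sources means that this is negligible for all sources $M_0,M_1$ in the class and all PPT $\mathcal{B}$. Partial lossiness and PRIV1-IND-ID security are taken with respect to the same type (adaptive or selective) of adversaries. *)

theory Defs
  imports
    "HOL-Probability.Probability"
    "HOL-Computational_Algebra.Polynomial"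
    "HOL-Library.Sublist"
    "HOL-Library.Monad_Syntax"
begin

section \<open>Probabilistic polynomial time\<close>

text \<open>The machine model is a WHILE language in the style of Jones: data are binary trees, programs
  transform one tree into another, fair coins are available, and every operation is charged at
  least the size of the data that it copies (so no exponential blow-up by sharing is possible).
  Up to a polynomial, running time agrees with that of probabilistic Turing machines.\<close>

datatype tree = Leaf | Node tree tree

datatype prog =
    Ident | Nul | Head | Tail | Flip
  | Then prog prog
  | Fork prog prog
  | Cond prog prog prog
  | While prog prog

primrec head :: "tree \<Rightarrow> tree" where
  "head Leaf = Leaf" | "head (Node a b) = a"

primrec tail :: "tree \<Rightarrow> tree" where
  "tail Leaf = Leaf" | "tail (Node a b) = b"

text \<open>\<open>exec p x D\<close>: the program \<open>p\<close> halts on input \<open>x\<close> for all coin tosses, and \<open>D\<close> is the joint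
  distribution of its output and its running time. A test succeeds iff its value is not \<open>Leaf\<close>.\<close>

inductive exec :: "prog \<Rightarrow> tree \<Rightarrow> (tree \<times> nat) pmf \<Rightarrow> bool" where
  Ident: "exec Ident x (return_pmf (x, Suc (size x)))"
| Nul: "exec Nul x (return_pmf (Leaf, 1))"
| Head: "exec Head x (return_pmf (head x, Suc (size x)))"
| Tail: "exec Tail x (return_pmf (tail x, Suc (size x)))"
| Flip: "exec Flip x (map_pmf (\<lambda>b. (if b then Node Leaf Leaf else Leaf, 2)) (bernoulli_pmf (1/2)))"
| Then: "exec p x D \<Longrightarrow> (\<And>y t. (y, t) \<in> set_pmf D \<Longrightarrow> exec q y (E y)) \<Longrightarrow>
    exec (Then p q) x (bind_pmf D (\<lambda>(y, t). map_pmf (\<lambda>(z, u). (z, t + u)) (E y)))"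
| Fork: "exec p x D \<Longrightarrow> exec q x E \<Longrightarrow>
    exec (Fork p q) x
      (bind_pmf D (\<lambda>(y, t). map_pmf (\<lambda>(z, u). (Node y z, Suc (size x + t + u))) E))"
| Cond: "exec b x D \<Longrightarrow>
    (\<And>v t. (v, t) \<in> set_pmf D \<Longrightarrow> exec (if v \<noteq> Leaf then p else q) x (E v)) \<Longrightarrow>
    exec (Cond b p q) x
      (bind_pmf D (\<lambda>(v, t). map_pmf (\<lambda>(z, u). (z, Suc (size x + t + u))) (E v)))"
| While: "exec (Cond b (Then p (While b p)) Ident) x D \<Longrightarrow> exec (While b p) x D"

class encodable =
  fixes encode :: "'a \<Rightarrow> tree"
  assumes inj_encode: "inj encode"

instantiation tree :: encodable
begin
definition "encode (x :: tree) = x"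
instance by standard (simp add: encode_tree_def inj_def)
end

instantiation bool :: encodable
begin
definition "encode (b :: bool) = (if b then Node Leaf Leaf else Leaf)"
instance by standard (simp add: encode_bool_def inj_def)
end

text \<open>Natural numbers are encoded in unary.\<close>

instantiation nat :: encodable
begin
primrec encode_nat :: "nat \<Rightarrow> tree" where
  "encode_nat 0 = Leaf" | "encode_nat (Suc n) = Node Leaf (encode_nat n)"
instance
proof (standard, rule injI)
  fix m n :: nat
  show "encode m = encode n \<Longrightarrow> m = n"
  proof (induction m arbitrary: n)
    case 0 then show ?case by (cases n) auto
  next
    case (Suc m) then show ?case by (cases n) auto
  qed
qed
end

instantiation prod :: (encodable, encodable) encodable
begin
definition "encode p = Node (encode (fst p)) (encode (snd p))"
instance by standard (auto simp: encode_prod_def inj_def dest: injD[OF inj_encode])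
end

instantiation sum :: (encodable, encodable) encodable
begin
definition "encode s =
  (case s of Inl a \<Rightarrow> Node Leaf (encode a) | Inr b \<Rightarrow> Node (Node Leaf Leaf) (encode b))"
instance by standard
  (auto simp: encode_sum_def inj_def split: sum.splits dest: injD[OF inj_encode])
end

instantiation option :: (encodable) encodable
begin
definition "encode x = (case x of None \<Rightarrow> Leaf | Some a \<Rightarrow> Node Leaf (encode a))"
instance by standard
  (auto simp: encode_option_def inj_def split: option.splits dest: injD[OF inj_encode])
end

instantiation list :: (encodable) encodable
begin
primrec encode_list :: "'a list \<Rightarrow> tree" where
  "encode_list [] = Leaf" | "encode_list (x # xs) = Node (encode x) (encode_list xs)"
instance
proof (standard, rule injI)
  fix xs ys :: "'a list"
  show "encode xs = encode ys \<Longrightarrow> xs = ys"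
  proof (induction xs arbitrary: ys)
    case Nil then show ?case by (cases ys) auto
  next
    case (Cons x xs) then show ?case by (cases ys) (auto dest: injD[OF inj_encode])
  qed
qed
end

instantiation int :: encodable
begin
definition "encode (i :: int) = encode (i < 0, nat \<bar>i\<bar>)"
instance
proof (standard, rule injI)
  fix i j :: int
  assume "encode i = encode j"
  then have "(i < 0, nat \<bar>i\<bar>) = (j < 0, nat \<bar>j\<bar>)"
    unfolding encode_int_def by (rule injD[OF inj_encode])
  then show "i = j" by auto
qed
end

instantiation rat :: encodable
begin
definition "encode (r :: rat) = encode (quotient_of r)"
instance
proof (standard, rule injI)
  fix r s :: rat
  assume "encode r = encode s"
  then have "quotient_of r = quotient_of s"
    unfolding encode_rat_def by (rule injD[OF inj_encode])
  then show "r = s" by (simp add: quotient_of_inject_eq)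
qed
end

definition ppt :: "('a::encodable \<Rightarrow> 'b::encodable pmf) \<Rightarrow> bool" where
  "ppt f \<longleftrightarrow> (\<exists>(p :: prog) (T :: nat poly). \<forall>x. \<exists>D. exec p (encode x) D \<and>
     map_pmf fst D = map_pmf encode (f x) \<and>
     (\<forall>(y, t) \<in> set_pmf D. t \<le> poly T (size (encode x))))"

abbreviation poly_time :: "('a::encodable \<Rightarrow> 'b::encodable) \<Rightarrow> bool" where
  "poly_time f \<equiv> ppt (\<lambda>x. return_pmf (f x))"

definition negligible_fun :: "(nat \<Rightarrow> real) \<Rightarrow> bool" where
  "negligible_fun f \<longleftrightarrow> (\<forall>c::nat. \<forall>\<^sub>F \<rho> in sequentially. \<bar>f \<rho>\<bar> < 1 / real \<rho> ^ c)"

text \<open>Non-negligible is understood as bounded below by an inverse polynomial for all large \<open>\<rho>\<close>;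
  with the weaker reading \<open>\<not> negligible_fun\<close>, two non-negligible functions may have a vanishing
  product.\<close>

definition non_negligible_fun :: "(nat \<Rightarrow> real) \<Rightarrow> bool" where
  "non_negligible_fun f \<longleftrightarrow> (\<exists>c::nat. \<forall>\<^sub>F \<rho> in sequentially. f \<rho> \<ge> 1 / real \<rho> ^ c)"


section \<open>Hierarchical identity-based trapdoor functions\<close>

text \<open>A hierarchical identity is the list of its components. Public parameters, keys and function
  values are arbitrary trees; function inputs are bit strings.\<close>

type_synonym ident = "bool list list"

record params =
  levels :: nat
  id_len :: "nat \<Rightarrow> nat"
  inp_len :: "nat \<Rightarrow> nat"

record hib_tdf =
  Setup :: "nat \<Rightarrow> nat \<Rightarrow> nat \<Rightarrow> nat \<Rightarrow> tree pmf"
  InpSp :: "tree \<Rightarrow> bool list set"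
  IdSp :: "tree \<Rightarrow> ident set"
  MKg :: "tree \<Rightarrow> (tree \<times> tree) pmf"
  Kg :: "tree \<Rightarrow> tree \<Rightarrow> ident \<Rightarrow> tree pmf"
  Del :: "tree \<Rightarrow> tree \<Rightarrow> ident \<Rightarrow> tree \<Rightarrow> bool list \<Rightarrow> tree pmf"
  Eval :: "tree \<Rightarrow> tree \<Rightarrow> ident \<Rightarrow> bool list \<Rightarrow> tree"
  Inv :: "tree \<Rightarrow> tree \<Rightarrow> ident \<Rightarrow> tree \<Rightarrow> tree \<Rightarrow> bool list"

definition gen_pms :: "params \<Rightarrow> hib_tdf \<Rightarrow> nat \<Rightarrow> tree pmf" where
  "gen_pms pp HF \<rho> = Setup HF \<rho> (levels pp) (id_len pp \<rho>) (inp_len pp \<rho>)"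

inductive user_key :: "hib_tdf \<Rightarrow> tree \<Rightarrow> tree \<Rightarrow> tree \<Rightarrow> ident \<Rightarrow> tree \<Rightarrow> bool"
  for HF pms mpk msk where
  generated: "u \<in> IdSp HF pms \<Longrightarrow> sk \<in> set_pmf (Kg HF pms msk u) \<Longrightarrow>
    user_key HF pms mpk msk u sk"
| delegated: "user_key HF pms mpk msk u sk \<Longrightarrow> u @ [c] \<in> IdSp HF pms \<Longrightarrow>
    sk' \<in> set_pmf (Del HF pms mpk u sk c) \<Longrightarrow> user_key HF pms mpk msk (u @ [c]) sk'"

definition hib_tdf :: "params \<Rightarrow> hib_tdf \<Rightarrow> bool" where
  "hib_tdf pp HF \<longleftrightarrow>
     ppt (\<lambda>(\<rho>, d, \<mu>, n). Setup HF \<rho> d \<mu> n) \<and>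
     ppt (MKg HF) \<and>
     ppt (\<lambda>(pms, msk, u). Kg HF pms msk u) \<and>
     ppt (\<lambda>(pms, mpk, u, sk, c). Del HF pms mpk u sk c) \<and>
     poly_time (\<lambda>(pms, mpk, u, x). Eval HF pms mpk u x) \<and>
     poly_time (\<lambda>(pms, mpk, u, sk, y). Inv HF pms mpk u sk y) \<and>
     (\<forall>\<rho>. \<forall>pms \<in> set_pmf (gen_pms pp HF \<rho>).
        (\<forall>u \<in> IdSp HF pms. 1 \<le> length u \<and> length u \<le> levels pp \<and>
           (\<forall>c \<in> set u. length c = id_len pp \<rho>)) \<and>
        (\<forall>(mpk, msk) \<in> set_pmf (MKg HF pms). \<forall>u sk. user_key HF pms mpk msk u sk \<longrightarrow>
           (\<forall>x \<in> InpSp HF pms. Inv HF pms mpk u sk (Eval HF pms mpk u x) = x)))"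

text \<open>Of a sibling only the components that differ from \<open>HF\<close> are recorded.\<close>

record sibling =
  AuxSp :: "tree \<Rightarrow> tree set"
  LMKg :: "tree \<Rightarrow> tree \<Rightarrow> (tree \<times> tree) pmf"
  LKg :: "tree \<Rightarrow> tree \<Rightarrow> ident \<Rightarrow> tree pmf"

definition sibling :: "params \<Rightarrow> hib_tdf \<Rightarrow> sibling \<Rightarrow> bool" where
  "sibling pp HF LHF \<longleftrightarrow>
     (\<forall>\<rho>. \<forall>pms \<in> set_pmf (gen_pms pp HF \<rho>). encode ` IdSp HF pms \<subseteq> AuxSp LHF pms) \<and>
     ppt (\<lambda>(pms, aux). LMKg LHF pms aux) \<and>
     ppt (\<lambda>(pms, msk, u). LKg LHF pms msk u)"

definition lossiness :: "'a set \<Rightarrow> ('a \<Rightarrow> 'b) \<Rightarrow> real" where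
  "lossiness D f = log 2 (real (card D) / real (card (f ` D)))"

abbreviation loss :: "hib_tdf \<Rightarrow> tree \<Rightarrow> tree \<Rightarrow> ident \<Rightarrow> real" where
  "loss HF pms mpk u \<equiv> lossiness (InpSp HF pms) (Eval HF pms mpk u)"


section \<open>Adversaries\<close>

datatype security = Adaptive | Selective

datatype request = CreateKey ident | Delegate ident "bool list" | RevealKey ident

instantiation request :: encodable
begin
definition "encode r = (case r of
    CreateKey u \<Rightarrow> encode (Inl u :: ident + (ident \<times> bool list) + ident)
  | Delegate u c \<Rightarrow> encode (Inr (Inl (u, c)) :: ident + (ident \<times> bool list) + ident)
  | RevealKey u \<Rightarrow> encode (Inr (Inr u) :: ident + (ident \<times> bool list) + ident))"
instance by standard
  (auto simp: encode_request_def inj_def split: request.splits dest: injD[OF inj_encode])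
end

text \<open>An adversary is a stateful machine. On \<open>(\<rho>, pms)\<close>, \<open>commit\<close> yields \<open>id\<^sup>\<dagger>\<close> and a state. Given the
  state and the last message of the challenger, \<open>act\<close> yields either a key query and a new state, or
  the challenge identity \<open>id\<^sup>\<star>\<close> with a further output. The first message handed to \<open>act\<close> is the
  master public key; later ones are answers, where \<open>None\<close> stands for \<open>\<bottom>\<close> and for the empty answer to
  a creation query. The function \<open>queries\<close> bounds the number of key queries.\<close>

record 'o adversary =
  queries :: "nat \<Rightarrow> nat"
  commit :: "nat \<times> tree \<Rightarrow> (ident \<times> tree) pmf"
  act :: "tree \<times> tree option \<Rightarrow> (request \<times> tree + ident \<times> 'o) pmf"

definition new_QS :: "request \<Rightarrow> ident set \<Rightarrow> ident set" where
  "new_QS r QS = (case r of CreateKey u \<Rightarrow> insert u QS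
     | Delegate u c \<Rightarrow> insert (u @ [c]) QS | RevealKey u \<Rightarrow> QS)"

definition new_IS :: "request \<Rightarrow> ident set \<Rightarrow> ident set \<Rightarrow> ident set" where
  "new_IS r QS IS = (case r of RevealKey u \<Rightarrow> if u \<in> QS then insert u IS else IS | _ \<Rightarrow> IS)"

text \<open>\<open>reach A \<rho> pms idd QS IS k len st msg\<close>: for some messages of the challenger, of total size \<open>len\<close>,
  the adversary has committed to \<open>idd\<close>, has made \<open>k\<close> queries leading to \<open>QS\<close> and \<open>IS\<close>, and is about to
  act in state \<open>st\<close> upon \<open>msg\<close>. The messages are arbitrary, so that running time and compliance with
  the rules do not depend on the world in which the adversary is run.\<close>

inductive reach :: "('o, 'z) adversary_scheme \<Rightarrow> nat \<Rightarrow> tree \<Rightarrow> ident \<Rightarrow> ident set \<Rightarrow> ident set \<Rightarrow>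
    nat \<Rightarrow> nat \<Rightarrow> tree \<Rightarrow> tree option \<Rightarrow> bool"
  for A \<rho> pms where
  start: "(idd, st) \<in> set_pmf (commit A (\<rho>, pms)) \<Longrightarrow>
    reach A \<rho> pms idd {} {} 0 (size pms + size mpk) st (Some mpk)"
| query: "reach A \<rho> pms idd QS IS k len st msg \<Longrightarrow>
    Inl (r, st') \<in> set_pmf (act A (st, msg)) \<Longrightarrow>
    reach A \<rho> pms idd (new_QS r QS) (new_IS r QS IS) (Suc k) (len + size (encode msg')) st' msg'"

text \<open>The total running time is polynomial in \<open>\<rho>\<close> and the total size of the received messages: there
  are polynomially many activations, each is polynomial in its input, and the carried state cannot
  grow exponentially over the activations.\<close>

definition ppt_adversary :: "('o::encodable, 'z) adversary_scheme \<Rightarrow> bool" where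
  "ppt_adversary A \<longleftrightarrow> ppt (commit A) \<and> ppt (act A) \<and>
     (\<exists>Q :: nat poly. \<forall>\<rho>. queries A \<rho> \<le> poly Q \<rho>) \<and>
     (\<exists>S :: nat poly. \<forall>\<rho> pms idd QS IS k len st msg. reach A \<rho> pms idd QS IS k len st msg \<longrightarrow>
        size st \<le> poly S (\<rho> + len)) \<and>
     (\<forall>\<rho> pms idd QS IS k len st msg. reach A \<rho> pms idd QS IS k len st msg \<longrightarrow>
        k \<le> queries A \<rho>)"

definition legal_request :: "security \<Rightarrow> ident set \<Rightarrow> ident \<Rightarrow> ident set \<Rightarrow> request \<Rightarrow> bool" where
  "legal_request sec Ids idd QS r = (case r of
     CreateKey u \<Rightarrow> u \<in> Ids
   | Delegate u c \<Rightarrow> u \<in> QS \<and> u @ [c] \<in> Ids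
   | RevealKey u \<Rightarrow> sec = Selective \<longrightarrow> \<not> prefix u idd)"

definition legal_challenge :: "security \<Rightarrow> ident set \<Rightarrow> ident \<Rightarrow> ident set \<Rightarrow> ident \<Rightarrow> bool" where
  "legal_challenge sec Ids idd IS ids \<longleftrightarrow> ids \<in> Ids \<and>
     (case sec of Selective \<Rightarrow> ids = idd | Adaptive \<Rightarrow> \<forall>u \<in> IS. \<not> prefix u ids)"

definition legal :: "security \<Rightarrow> (nat \<Rightarrow> tree pmf) \<Rightarrow> (tree \<Rightarrow> ident set) \<Rightarrow>
    ('o, 'z) adversary_scheme \<Rightarrow> bool" where
  "legal sec S Ids A \<longleftrightarrow> (\<forall>\<rho>. \<forall>pms \<in> set_pmf (S \<rho>).
     (\<forall>(idd, st) \<in> set_pmf (commit A (\<rho>, pms)). idd \<in> Ids pms) \<and>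
     (\<forall>idd QS IS k len st msg. reach A \<rho> pms idd QS IS k len st msg \<longrightarrow>
        (\<forall>r st'. Inl (r, st') \<in> set_pmf (act A (st, msg)) \<longrightarrow>
           legal_request sec (Ids pms) idd QS r) \<and>
        (\<forall>ids out. Inr (ids, out) \<in> set_pmf (act A (st, msg)) \<longrightarrow>
           legal_challenge sec (Ids pms) idd IS ids)))"

text \<open>The challenger keeps a table of the created keys, whose domain is \<open>QS\<close>, and the set \<open>IS\<close> as a
  list without repetitions. Creating a key anew for an identity replaces the previous one.\<close>

type_synonym key_table = "ident \<Rightarrow> tree option"

definition answer :: "(ident \<Rightarrow> tree pmf) \<Rightarrow> (ident \<Rightarrow> tree \<Rightarrow> bool list \<Rightarrow> tree pmf) \<Rightarrow>
    key_table \<Rightarrow> ident list \<Rightarrow> request \<Rightarrow> (tree option \<times> key_table \<times> ident list) pmf" where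
  "answer kg del keys IS r = (case r of
     CreateKey u \<Rightarrow> do {sk \<leftarrow> kg u; return_pmf (None, keys(u \<mapsto> sk), IS)}
   | Delegate u c \<Rightarrow> (case keys u of
        None \<Rightarrow> return_pmf (None, keys, IS)
      | Some sk \<Rightarrow> do {sk' \<leftarrow> del u sk c; return_pmf (None, keys(u @ [c] \<mapsto> sk'), IS)})
   | RevealKey u \<Rightarrow> (case keys u of
        None \<Rightarrow> return_pmf (None, keys, IS)
      | Some sk \<Rightarrow> return_pmf (Some sk, keys, List.insert u IS)))"

text \<open>The first argument bounds the number of queries; the result is \<open>None\<close> if it is exceeded, which
  never happens for \<open>k = queries A \<rho>\<close> if \<open>ppt_adversary A\<close>.\<close>

primrec interact :: "nat \<Rightarrow> (tree \<times> tree option \<Rightarrow> (request \<times> tree + ident \<times> 'o) pmf) \<Rightarrow>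
    (ident \<Rightarrow> tree pmf) \<Rightarrow> (ident \<Rightarrow> tree \<Rightarrow> bool list \<Rightarrow> tree pmf) \<Rightarrow>
    key_table \<Rightarrow> ident list \<Rightarrow> tree \<Rightarrow> tree option \<Rightarrow> (ident \<times> 'o \<times> ident list) option pmf" where
  "interact 0 move kg del keys IS st msg = do {
     a \<leftarrow> move (st, msg);
     return_pmf (case a of Inl _ \<Rightarrow> None | Inr (ids, out) \<Rightarrow> Some (ids, out, IS))}"
| "interact (Suc k) move kg del keys IS st msg = do {
     a \<leftarrow> move (st, msg);
     (case a of
        Inr (ids, out) \<Rightarrow> return_pmf (Some (ids, out, IS))
      | Inl (r, st') \<Rightarrow> do {
          (msg', keys', IS') \<leftarrow> answer kg del keys IS r;
          interact k move kg del keys' IS' st' msg'})}"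


section \<open>Partial lossiness and universality\<close>

datatype world = REAL | LOSSY

text \<open>Here the further output of the adversary is the bit \<open>d\<^sub>A\<close>. The result of the game consists of
  \<open>pms\<close>, \<open>mpk\<^sub>1\<close>, \<open>msk\<^sub>1\<close>, \<open>IS\<close>, \<open>id\<^sup>\<star>\<close> and \<open>d\<^sub>A\<close>.\<close>

definition game :: "params \<Rightarrow> hib_tdf \<Rightarrow> sibling \<Rightarrow> bool adversary \<Rightarrow> world \<Rightarrow> nat \<Rightarrow>
    (tree \<times> tree \<times> tree \<times> ident list \<times> ident \<times> bool) option pmf" where
  "game pp HF LHF A w \<rho> = do {
     pms \<leftarrow> gen_pms pp HF \<rho>;
     (idd, st) \<leftarrow> commit A (\<rho>, pms);
     (mpk0, msk0) \<leftarrow> MKg HF pms;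
     (mpk1, msk1) \<leftarrow> LMKg LHF pms (encode idd);
     res \<leftarrow> (case w of
         REAL \<Rightarrow> interact (queries A \<rho>) (act A) (Kg HF pms msk0) (Del HF pms mpk0)
                   Map.empty [] st (Some mpk0)
       | LOSSY \<Rightarrow> interact (queries A \<rho>) (act A) (LKg LHF pms msk1) (Del HF pms mpk1)
                   Map.empty [] st (Some mpk1));
     return_pmf (map_option (\<lambda>(ids, dA, IS). (pms, mpk1, msk1, IS, ids, dA)) res)}"

type_synonym pre_output = "rat \<times> tree \<times> tree \<times> tree \<times> ident list \<times> ident \<Rightarrow> bool pmf"

text \<open>As an input of an algorithm, \<open>\<zeta>\<close> is rational; its encoding is unary, so that the running time of
  the pre-output stage may be polynomial in \<open>1 / \<zeta>\<close>.\<close>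

definition d1 :: "hib_tdf \<Rightarrow> real \<Rightarrow> tree \<Rightarrow> tree \<Rightarrow> ident list \<Rightarrow> ident \<Rightarrow> bool" where
  "d1 HF \<omega> pms mpk1 IS ids \<longleftrightarrow>
     (\<forall>u \<in> set IS. loss HF pms mpk1 u = 0) \<and> loss HF pms mpk1 ids \<ge> \<omega>"

text \<open>The joint distribution of the adversary's bit and the no-abort bit.\<close>

definition loss_exp :: "params \<Rightarrow> hib_tdf \<Rightarrow> sibling \<Rightarrow> pre_output \<Rightarrow> (nat \<Rightarrow> real) \<Rightarrow>
    (nat \<Rightarrow> rat) \<Rightarrow> bool adversary \<Rightarrow> world \<Rightarrow> nat \<Rightarrow> (bool \<times> bool) pmf" where
  "loss_exp pp HF LHF P \<omega> \<zeta> A w \<rho> = do {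
     res \<leftarrow> game pp HF LHF A w \<rho>;
     (case res of
        None \<Rightarrow> return_pmf (False, False)
      | Some (pms, mpk1, msk1, IS, ids, dA) \<Rightarrow> do {
          d2 \<leftarrow> P (\<zeta> \<rho>, pms, mpk1, msk1, IS, ids);
          return_pmf (dA, d1 HF (\<omega> \<rho>) pms mpk1 IS ids \<and> d2)})}"

definition adv_lossy :: "params \<Rightarrow> hib_tdf \<Rightarrow> sibling \<Rightarrow> pre_output \<Rightarrow> (nat \<Rightarrow> real) \<Rightarrow>
    (nat \<Rightarrow> rat) \<Rightarrow> bool adversary \<Rightarrow> nat \<Rightarrow> real" where
  "adv_lossy pp HF LHF P \<omega> \<zeta> A \<rho> =
     \<bar>measure_pmf.prob (loss_exp pp HF LHF P \<omega> \<zeta> A REAL \<rho>) {(dA, na). dA \<and> na} -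
      measure_pmf.prob (loss_exp pp HF LHF P \<omega> \<zeta> A LOSSY \<rho>) {(dA, na). dA \<and> na}\<bar>"

text \<open>The first argument of \<open>\<delta>\<close> is the number of key queries.\<close>

definition partially_lossy :: "security \<Rightarrow> params \<Rightarrow> hib_tdf \<Rightarrow> sibling \<Rightarrow> pre_output \<Rightarrow>
    (nat \<Rightarrow> real) \<Rightarrow> (nat \<Rightarrow> nat \<Rightarrow> real) \<Rightarrow> bool" where
  "partially_lossy sec pp HF LHF P \<omega> \<delta> \<longleftrightarrow> sibling pp HF LHF \<and> ppt P \<and>
     (\<forall>A \<zeta>. ppt_adversary A \<and> legal sec (gen_pms pp HF) (IdSp HF) A \<and>
        (\<forall>\<rho>. 0 < \<zeta> \<rho> \<and> \<zeta> \<rho> < 1) \<and> non_negligible_fun (\<lambda>\<rho>. real_of_rat (\<zeta> \<rho>)) \<longrightarrow>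
        (\<exists>\<epsilon>1 \<epsilon>2. non_negligible_fun \<epsilon>1 \<and> non_negligible_fun \<epsilon>2 \<and>
           (\<forall>\<rho>. \<delta> (queries A \<rho>) \<rho> = \<epsilon>1 \<rho> * \<epsilon>2 \<rho>) \<and>
           negligible_fun (adv_lossy pp HF LHF P \<omega> \<zeta> A) \<and>
           (\<forall>\<rho>. let E = loss_exp pp HF LHF P \<omega> \<zeta> A REAL \<rho> in
              measure_pmf.prob E {(dA, na). na} \<ge> \<epsilon>1 \<rho> \<and>
              (measure_pmf.prob E {(dA, na). dA} - 1/2 > real_of_rat (\<zeta> \<rho>) \<longrightarrow>
               cond_prob (measure_pmf E) fst snd - 1/2 > \<epsilon>2 \<rho> * real_of_rat (\<zeta> \<rho>)))))"

text \<open>The hash key is \<open>(pms, mpk\<^sub>1, id\<^sup>\<star>)\<close> as it arises in the \<open>LOSSY\<close> experiment with any adversary,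
  where \<open>id\<^sup>\<star>\<close> may depend on \<open>pms\<close> and \<open>mpk\<^sub>1\<close>; the hash function maps the input space onto its image. The usual condition,
  that two distinct inputs collide with probability at most \<open>1 / |range|\<close> given that the function is
  lossy, is stated here multiplied by the probability of lossiness, with the range size averaged
  over the hash keys.\<close>

definition lossy_at :: "hib_tdf \<Rightarrow> real \<Rightarrow>
    (tree \<times> tree \<times> tree \<times> ident list \<times> ident \<times> bool) option \<Rightarrow> bool" where
  "lossy_at HF \<omega> res = (case res of None \<Rightarrow> False
     | Some (pms, mpk1, msk1, IS, ids, dA) \<Rightarrow> loss HF pms mpk1 ids \<ge> \<omega>)"

definition collide :: "hib_tdf \<Rightarrow> bool list \<Rightarrow> bool list \<Rightarrow>
    (tree \<times> tree \<times> tree \<times> ident list \<times> ident \<times> bool) option \<Rightarrow> bool" where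
  "collide HF x x' res = (case res of None \<Rightarrow> False
     | Some (pms, mpk1, msk1, IS, ids, dA) \<Rightarrow> x \<in> InpSp HF pms \<and> x' \<in> InpSp HF pms \<and>
         Eval HF pms mpk1 ids x = Eval HF pms mpk1 ids x')"

definition range_size :: "hib_tdf \<Rightarrow>
    (tree \<times> tree \<times> tree \<times> ident list \<times> ident \<times> bool) option \<Rightarrow> nat" where
  "range_size HF res = (case res of None \<Rightarrow> 0
     | Some (pms, mpk1, msk1, IS, ids, dA) \<Rightarrow> card (Eval HF pms mpk1 ids ` InpSp HF pms))"

definition universal :: "security \<Rightarrow> params \<Rightarrow> hib_tdf \<Rightarrow> sibling \<Rightarrow> (nat \<Rightarrow> real) \<Rightarrow> bool" where
  "universal sec pp HF LHF \<omega> \<longleftrightarrow>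
     (\<forall>A \<rho> x x'. ppt_adversary A \<and> legal sec (gen_pms pp HF) (IdSp HF) A \<and> x \<noteq> x' \<longrightarrow>
        measure_pmf.prob (game pp HF LHF A LOSSY \<rho>)
          {res. lossy_at HF (\<omega> \<rho>) res \<and> collide HF x x' res} \<le>
        measure_pmf.expectation (game pp HF LHF A LOSSY \<rho>)
          (\<lambda>res. if lossy_at HF (\<omega> \<rho>) res then 1 / real (range_size HF res) else 0))"


section \<open>Deterministic hierarchical identity-based encryption\<close>

record hib_de =
  de_Setup :: "nat \<Rightarrow> nat \<Rightarrow> nat \<Rightarrow> nat \<Rightarrow> tree pmf"
  de_IdSp :: "tree \<Rightarrow> ident set"
  de_MKg :: "tree \<Rightarrow> (tree \<times> tree) pmf"
  de_Kg :: "tree \<Rightarrow> tree \<Rightarrow> ident \<Rightarrow> tree pmf"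
  de_Del :: "tree \<Rightarrow> tree \<Rightarrow> ident \<Rightarrow> tree \<Rightarrow> bool list \<Rightarrow> tree pmf"
  de_Enc :: "tree \<Rightarrow> tree \<Rightarrow> ident \<Rightarrow> bool list \<Rightarrow> tree"
  de_Dec :: "tree \<Rightarrow> tree \<Rightarrow> ident \<Rightarrow> tree \<Rightarrow> tree \<Rightarrow> bool list"

definition hib_de_of :: "hib_tdf \<Rightarrow> hib_de" where
  "hib_de_of HF = \<lparr>de_Setup = Setup HF, de_IdSp = IdSp HF, de_MKg = MKg HF, de_Kg = Kg HF,
     de_Del = Del HF, de_Enc = Eval HF, de_Dec = Inv HF\<rparr>"

definition de_gen_pms :: "params \<Rightarrow> hib_de \<Rightarrow> nat \<Rightarrow> tree pmf" where
  "de_gen_pms pp DE \<rho> = de_Setup DE \<rho> (levels pp) (id_len pp \<rho>) (inp_len pp \<rho>)"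

definition bitstrings :: "nat \<Rightarrow> bool list set" where
  "bitstrings k = {x. length x = k}"

definition min_entropy :: "nat \<Rightarrow> bool list pmf \<Rightarrow> real" where
  "min_entropy s X = - log 2 (Max (pmf X ` bitstrings s))"

definition source :: "real \<Rightarrow> nat \<Rightarrow> bool list pmf \<Rightarrow> bool" where
  "source t s X \<longleftrightarrow> set_pmf X \<subseteq> bitstrings s \<and> min_entropy s X \<ge> t"

definition sampleable_sources :: "(nat \<Rightarrow> real) \<Rightarrow> (nat \<Rightarrow> nat) \<Rightarrow> (nat \<Rightarrow> bool list pmf) set" where
  "sampleable_sources t s = {M. ppt M \<and> (\<forall>\<rho>. source (t \<rho>) (s \<rho>) (M \<rho>))}"

text \<open>Here the further output of \<open>act\<close> is the state kept for the guessing stage, which receives the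
  challenge ciphertext.\<close>

record priv_adversary = "tree adversary" +
  guess :: "tree \<times> tree \<Rightarrow> bool pmf"

definition guess_exp :: "params \<Rightarrow> hib_de \<Rightarrow> priv_adversary \<Rightarrow> (nat \<Rightarrow> bool list pmf) \<Rightarrow> nat \<Rightarrow>
    bool pmf" where
  "guess_exp pp DE B M \<rho> = do {
     pms \<leftarrow> de_gen_pms pp DE \<rho>;
     (idd, st) \<leftarrow> commit B (\<rho>, pms);
     (mpk, msk) \<leftarrow> de_MKg DE pms;
     res \<leftarrow> interact (queries B \<rho>) (act B) (de_Kg DE pms msk) (de_Del DE pms mpk)
              Map.empty [] st (Some mpk);
     (case res of
        None \<Rightarrow> return_pmf False
      | Some (ids, st', IS) \<Rightarrow> do {
          m \<leftarrow> M \<rho>;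
          guess B (st', de_Enc DE pms mpk ids m)})}"

definition adv_priv1 :: "params \<Rightarrow> hib_de \<Rightarrow> priv_adversary \<Rightarrow> (nat \<Rightarrow> bool list pmf) \<Rightarrow>
    (nat \<Rightarrow> bool list pmf) \<Rightarrow> nat \<Rightarrow> real" where
  "adv_priv1 pp DE B M0 M1 \<rho> =
     pmf (guess_exp pp DE B M0 \<rho>) True - pmf (guess_exp pp DE B M1 \<rho>) True"

definition ppt_priv_adversary :: "security \<Rightarrow> params \<Rightarrow> hib_de \<Rightarrow> priv_adversary \<Rightarrow> bool" where
  "ppt_priv_adversary sec pp DE B \<longleftrightarrow> ppt_adversary B \<and> ppt (guess B) \<and>
     legal sec (de_gen_pms pp DE) (de_IdSp DE) B"

definition priv1_ind_id_secure :: "security \<Rightarrow> params \<Rightarrow> hib_de \<Rightarrow>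
    (nat \<Rightarrow> bool list pmf) set \<Rightarrow> bool" where
  "priv1_ind_id_secure sec pp DE C \<longleftrightarrow>
     (\<forall>M0 \<in> C. \<forall>M1 \<in> C. \<forall>B. ppt_priv_adversary sec pp DE B \<longrightarrow>
        negligible_fun (adv_priv1 pp DE B M0 M1))"

end

theory Submission
  imports Defs
begin

text \<open>
  From a distinguisher \<open>B\<close> between the sources \<open>M0\<close> and \<open>M1\<close> one obtains an adversary against the
  trapdoor function that simulates \<open>B\<close>, encrypts a message from \<open>M0\<close> or \<open>M1\<close> according to a fair coin
  and outputs whether \<open>B\<close> guesses the coin. In the \<open>REAL\<close> world its bit is \<open>1\<close> with probability
  \<open>1/2 + adv/2\<close>, so a noticeable advantage of \<open>B\<close> survives the conditioning on the no-abort event. In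
  the \<open>LOSSY\<close> world, without abort, the ciphertext is the value of a universal hash function of range
  size at most \<open>2 powr (n - \<omega>)\<close> at a point of min-entropy at least \<open>t\<close>; by the leftover hash lemma the
  bit is \<open>1\<close> with probability \<open>1/2\<close> up to \<open>O(\<epsilon>)\<close>. The no-abort probabilities of the two worlds are
  compared by a second adversary, which runs \<open>B\<close> and always outputs \<open>1\<close>.

  Partial lossiness may be invoked only for a noticeable \<open>\<zeta>\<close>, whereas the advantage of \<open>B\<close> may be
  large for infinitely many and small for infinitely many other security parameters. So \<open>\<zeta>\<close> is chosen
  as an inverse polynomial that the advantage is assumed to exceed infinitely often, which proves
  that the advantage is negligible. As \<open>\<delta>\<close> is eventually bounded, the product of \<open>\<delta>\<close> with the
  advantage is negligible, too, and serves as \<open>\<nu>\<close> in the inequality between the advantages.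
\<close>

section \<open>Closure properties of probabilistic polynomial time\<close>

lemma poly_nat_mono:
  fixes T :: "nat poly"
  shows "m \<le> n \<Longrightarrow> poly T m \<le> poly T n"
  by (induction T) (auto intro!: add_mono mult_mono)

text \<open>Each construct is charged at least the size of its result. Thus the time bound of a
  first program also limits the size of the input handed to a second one.\<close>

lemma exec_size_le_time: "exec p x D \<Longrightarrow> (y, t) \<in> set_pmf D \<Longrightarrow> size y \<le> t"
proof (induction arbitrary: y t rule: exec.induct)
  case (Head x) then show ?case by (cases x) auto
next
  case (Tail x) then show ?case by (cases x) auto
next
  case (Then p x D q E) then show ?case by fastforce
next
  case (Fork p x D q E) then show ?case by fastforce
next
  case (Cond b x D p q E) then show ?case by fastforce
qed auto

text \<open>A version of \<open>ppt\<close> for one input tree and an arbitrary distribution on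
  trees. Programs can then be composed through intermediate trees that encode no value of any
  type.\<close>

definition computes :: "prog \<Rightarrow> nat poly \<Rightarrow> tree \<Rightarrow> tree pmf \<Rightarrow> bool" where
  "computes p T x f \<longleftrightarrow> (\<exists>D. exec p x D \<and> map_pmf fst D = f \<and>
     (\<forall>(y, t) \<in> set_pmf D. t \<le> poly T (size x)))"

lemma ppt_iff_computes:
  "ppt f \<longleftrightarrow> (\<exists>p T. \<forall>x. computes p T (encode x) (map_pmf encode (f x)))"
  unfolding ppt_def computes_def ..

lemma pptI: "(\<And>x. computes p T (encode x) (map_pmf encode (f x))) \<Longrightarrow> ppt f"
  unfolding ppt_iff_computes by blast

lemma poly_timeI: "(\<And>x. computes p T (encode x) (return_pmf (encode (f x)))) \<Longrightarrow> poly_time f"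
  by (rule pptI) simp

text \<open>Together with its mirror image this gives the two branches of a conditional the common
  bound \<open>T + U\<close>.\<close>

lemma computes_add_left: "computes p T x f \<Longrightarrow> computes p (T + U) x f"
  unfolding computes_def by (fastforce intro: trans_le_add1)

lemma computes_add_right: "computes p U x f \<Longrightarrow> computes p (T + U) x f"
  unfolding computes_def by (fastforce intro: trans_le_add2)

lemma computes_Ident: "computes Ident [:1, 1:] x (return_pmf x)"
  unfolding computes_def by (intro exI conjI, rule exec.Ident) auto

lemma computes_Nul: "computes Nul 1 x (return_pmf Leaf)"
  unfolding computes_def by (intro exI conjI, rule exec.Nul) auto

lemma computes_Head: "computes Head [:1, 1:] x (return_pmf (head x))"
  unfolding computes_def by (intro exI conjI, rule exec.Head) auto

lemma computes_Tail: "computes Tail [:1, 1:] x (return_pmf (tail x))"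
  unfolding computes_def by (intro exI conjI, rule exec.Tail) auto

lemma computes_Flip: "computes Flip 2 x (map_pmf encode (bernoulli_pmf (1/2)))"
  unfolding computes_def
  by (intro exI conjI, rule exec.Flip)
    (auto simp: pmf.map_comp o_def encode_bool_def intro!: map_pmf_cong)

text \<open>The intermediate result is no larger than the time \<open>poly T (size x)\<close> spent
  on it, and bounds with natural coefficients are monotone; hence the second summand
  \<open>pcompose U T\<close>.\<close>

lemma computes_Then:
  assumes p: "computes p T x f" and q: "\<And>y. y \<in> set_pmf f \<Longrightarrow> computes q U y (h y)"
  shows "computes (Then p q) (T + pcompose U T) x (bind_pmf f h)"
proof -
  obtain D where D: "exec p x D" "map_pmf fst D = f"
    and Dt: "\<And>y t. (y, t) \<in> set_pmf D \<Longrightarrow> t \<le> poly T (size x)"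
    using p unfolding computes_def by fast
  have f: "y \<in> set_pmf f" if "(y, t) \<in> set_pmf D" for y t
    using that D(2) by force
  obtain E where E: "\<And>y. y \<in> set_pmf f \<Longrightarrow> exec q y (E y) \<and> map_pmf fst (E y) = h y \<and>
     (\<forall>(z, u) \<in> set_pmf (E y). u \<le> poly U (size y))"
    using q unfolding computes_def by metis
  let ?R = "bind_pmf D (\<lambda>(y, t). map_pmf (\<lambda>(z, u). (z, t + u)) (E y))"
  have "exec (Then p q) x ?R"
    using D(1) E f by (intro exec.Then) auto
  moreover have "map_pmf fst ?R = bind_pmf f h"
    unfolding D(2)[symmetric] map_bind_pmf bind_map_pmf
    using E f by (intro bind_pmf_cong) (auto simp: pmf.map_comp o_def case_prod_beta D(2))
  moreover have "t + u \<le> poly (T + pcompose U T) (size x)"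
    if yt: "(y, t) \<in> set_pmf D" and zu: "(z, u) \<in> set_pmf (E y)" for y t z u
  proof -
    have "size y \<le> poly T (size x)"
      using exec_size_le_time[OF D(1) yt] Dt[OF yt] by linarith
    then have "u \<le> poly U (poly T (size x))"
      using E[OF f[OF yt]] zu poly_nat_mono[of "size y" _ U] by fastforce
    then show ?thesis using Dt[OF yt] by (simp add: poly_pcompose)
  qed
  ultimately show ?thesis unfolding computes_def by (intro exI[of _ ?R]) fastforce
qed

lemma computes_Fork:
  assumes p: "computes p T x f" and q: "computes q U x g"
  shows "computes (Fork p q) ([:1, 1:] + T + U) x
    (bind_pmf f (\<lambda>y. map_pmf (Node y) g))"
proof -
  obtain D where D: "exec p x D" "map_pmf fst D = f"
    and Dt: "\<And>y t. (y, t) \<in> set_pmf D \<Longrightarrow> t \<le> poly T (size x)"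
    using p unfolding computes_def by fast
  obtain E where E: "exec q x E" "map_pmf fst E = g"
    and Et: "\<And>y t. (y, t) \<in> set_pmf E \<Longrightarrow> t \<le> poly U (size x)"
    using q unfolding computes_def by fast
  let ?R = "bind_pmf D (\<lambda>(y, t). map_pmf (\<lambda>(z, u). (Node y z, Suc (size x + t + u))) E)"
  have "exec (Fork p q) x ?R" using D(1) E(1) by (rule exec.Fork)
  moreover have "map_pmf fst ?R = bind_pmf f (\<lambda>y. map_pmf (Node y) g)"
    unfolding D(2)[symmetric] E(2)[symmetric] map_bind_pmf bind_map_pmf
    by (intro bind_pmf_cong) (auto simp: pmf.map_comp o_def case_prod_beta)
  moreover have "Suc (size x + t + u) \<le> poly ([:1, 1:] + T + U) (size x)"
    if "(y, t) \<in> set_pmf D" "(z, u) \<in> set_pmf E" for y t z u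
    using Dt[OF that(1)] Et[OF that(2)] by simp
  ultimately show ?thesis unfolding computes_def by (intro exI[of _ ?R]) fastforce
qed

text \<open>The test is taken to be deterministic, so the branch that runs is known in advance and
  only this branch needs a bound.\<close>

lemma computes_Cond:
  assumes b: "computes b T x (return_pmf v)" and p: "computes (if v \<noteq> Leaf then p else q) U x f"
  shows "computes (Cond b p q) ([:1, 1:] + T + U) x f"
proof -
  obtain D where D: "exec b x D" "map_pmf fst D = return_pmf v"
    and Dt: "\<And>y t. (y, t) \<in> set_pmf D \<Longrightarrow> t \<le> poly T (size x)"
    using b unfolding computes_def by fast
  have v: "y = v" if "(y, t) \<in> set_pmf D" for y t
  proof -
    have "y \<in> set_pmf (map_pmf fst D)" using that by force
    then show ?thesis unfolding D(2) by simp
  qed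
  obtain E where E: "exec (if v \<noteq> Leaf then p else q) x E" "map_pmf fst E = f"
    and Et: "\<And>y t. (y, t) \<in> set_pmf E \<Longrightarrow> t \<le> poly U (size x)"
    using p unfolding computes_def by fast
  let ?R = "bind_pmf D (\<lambda>(v, t). map_pmf (\<lambda>(z, u). (z, Suc (size x + t + u))) E)"
  have "exec (Cond b p q) x ?R" using D(1) E(1) v by (intro exec.Cond) auto
  moreover have "map_pmf fst ?R = bind_pmf D (\<lambda>_. f)"
    unfolding E(2)[symmetric] map_bind_pmf
    by (intro bind_pmf_cong) (auto simp: pmf.map_comp o_def case_prod_beta)
  moreover have "Suc (size x + t + u) \<le> poly ([:1, 1:] + T + U) (size x)"
    if "(y, t) \<in> set_pmf D" "(z, u) \<in> set_pmf E" for y t z u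
    using Dt[OF that(1)] Et[OF that(2)] by simp
  ultimately show ?thesis unfolding computes_def by (intro exI[of _ ?R]) fastforce
qed

section \<open>Closure under composition, pairing and case distinction\<close>

lemma ppt_bind_pmf:
  assumes "ppt f" and "ppt g"
  shows "ppt (\<lambda>x. bind_pmf (f x) g)"
proof -
  obtain p T where p: "\<And>x. computes p T (encode x) (map_pmf encode (f x))"
    using assms(1) unfolding ppt_iff_computes by blast
  obtain q U where q: "\<And>y. computes q U (encode y) (map_pmf encode (g y))"
    using assms(2) unfolding ppt_iff_computes by blast
  \<comment> \<open>Extends \<open>g\<close> to a kernel on all trees, as sequential composition is
    stated for trees. Only encodings occur as intermediate results, and there
    \<open>inv encode\<close> decodes correctly.\<close>
  let ?h = "\<lambda>z. map_pmf encode (g (inv encode z))"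
  have "computes (Then p q) (T + pcompose U T) (encode x)
      (bind_pmf (map_pmf encode (f x)) ?h)" for x
    using q by (intro computes_Then[OF p]) (auto simp: inv_f_f[OF inj_encode])
  moreover have "bind_pmf (map_pmf encode (f x)) ?h = map_pmf encode (bind_pmf (f x) g)" for x
    by (simp add: bind_map_pmf map_bind_pmf inv_f_f[OF inj_encode])
  ultimately show ?thesis unfolding ppt_iff_computes by metis
qed

lemma ppt_comp: "ppt g \<Longrightarrow> poly_time f \<Longrightarrow> ppt (\<lambda>x. g (f x))"
  using ppt_bind_pmf[of "\<lambda>x. return_pmf (f x)" g] by (simp add: bind_return_pmf)

lemma ppt_map_pmf: "poly_time g \<Longrightarrow> ppt f \<Longrightarrow> ppt (\<lambda>x. map_pmf g (f x))"
  using ppt_bind_pmf[of f "\<lambda>y. return_pmf (g y)"] by (simp add: map_pmf_def)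

lemma ppt_pair:
  assumes "ppt f" and "ppt g"
  shows "ppt (\<lambda>x. pair_pmf (f x) (g x))"
proof -
  obtain p T where p: "\<And>x. computes p T (encode x) (map_pmf encode (f x))"
    using assms(1) unfolding ppt_iff_computes by blast
  obtain q U where q: "\<And>y. computes q U (encode y) (map_pmf encode (g y))"
    using assms(2) unfolding ppt_iff_computes by blast
  have "map_pmf encode (pair_pmf (f x) (g x)) =
      bind_pmf (map_pmf encode (f x)) (\<lambda>y. map_pmf (Node y) (map_pmf encode (g x)))" for x
    by (simp add: pair_pmf_def map_bind_pmf bind_map_pmf map_pmf_def bind_assoc_pmf
        bind_return_pmf encode_prod_def)
  then show ?thesis using computes_Fork[OF p q] unfolding ppt_iff_computes by metis
qed

lemma poly_time_Pair: "poly_time f \<Longrightarrow> poly_time g \<Longrightarrow> poly_time (\<lambda>x. (f x, g x))"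
  using ppt_pair[of "\<lambda>x. return_pmf (f x)" "\<lambda>x. return_pmf (g x)"]
  by (simp add: pair_return_pmf1)

lemma poly_time_id: "poly_time (\<lambda>x. x)"
  by (rule poly_timeI, rule computes_Ident)

lemma poly_time_encode: "poly_time (encode :: 'a::encodable \<Rightarrow> tree)"
  by (rule poly_timeI[of Ident "[:1, 1:]"]) (simp only: encode_tree_def computes_Ident)

lemma poly_time_head: "poly_time head"
  by (rule poly_timeI[of Head "[:1, 1:]"]) (simp only: encode_tree_def computes_Head)

lemma poly_time_tail: "poly_time tail"
  by (rule poly_timeI[of Tail "[:1, 1:]"]) (simp only: encode_tree_def computes_Tail)

lemma poly_time_fst: "poly_time f \<Longrightarrow> poly_time (\<lambda>x. fst (f x))"
proof -
  have "computes Head [:1, 1:] (encode x) (return_pmf (encode (fst x)))" for x :: "'b \<times> 'c"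
    using computes_Head[of "encode x"] by (simp add: encode_prod_def)
  then have "poly_time (fst :: 'b \<times> 'c \<Rightarrow> 'b)" by (rule poly_timeI)
  then show "poly_time f \<Longrightarrow> ?thesis" by (rule ppt_comp)
qed

lemma poly_time_snd: "poly_time f \<Longrightarrow> poly_time (\<lambda>x. snd (f x))"
proof -
  have "computes Tail [:1, 1:] (encode x) (return_pmf (encode (snd x)))" for x :: "'b \<times> 'c"
    using computes_Tail[of "encode x"] by (simp add: encode_prod_def)
  then have "poly_time (snd :: 'b \<times> 'c \<Rightarrow> 'c)" by (rule poly_timeI)
  then show "poly_time f \<Longrightarrow> ?thesis" by (rule ppt_comp)
qed

text \<open>The input is carried along by pairing it with the intermediate result, so the second
  stage may depend on both.\<close>

lemma ppt_bind:
  assumes "ppt f" and "ppt (\<lambda>p. g (fst p) (snd p))"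
  shows "ppt (\<lambda>x. bind_pmf (f x) (g x))"
  using ppt_bind_pmf[OF ppt_pair[OF poly_time_id assms(1)] assms(2)]
  by (simp add: pair_pmf_def bind_return_pmf bind_assoc_pmf)

lemma computes_constant: "\<exists>p T. \<forall>x. computes p T x (return_pmf c)"
proof (induction c)
  case Leaf then show ?case using computes_Nul by blast
next
  case (Node a b)
  then obtain p T q U where "\<forall>x. computes p T x (return_pmf a)" "\<forall>x. computes q U x (return_pmf b)"
    by blast
  then have "computes (Fork p q) ([:1, 1:] + T + U) x (return_pmf (Node a b))" for x
    using computes_Fork[of p T x "return_pmf a" q U "return_pmf b"] by (simp add: bind_return_pmf)
  then show ?case by blast
qed

lemma poly_time_const: "poly_time (\<lambda>_. c)"
  using computes_constant[of "encode c"] by (auto intro: poly_timeI)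

lemma ppt_bernoulli: "ppt (\<lambda>_. bernoulli_pmf (1/2))"
  unfolding ppt_iff_computes using computes_Flip by blast

lemma ppt_if:
  assumes "poly_time b" and "ppt f" and "ppt g"
  shows "ppt (\<lambda>x. if b x then f x else g x)"
proof -
  obtain r R where r: "\<And>x. computes r R (encode x) (return_pmf (encode (b x)))"
    using assms(1) unfolding ppt_iff_computes by auto
  obtain p T where p: "\<And>x. computes p T (encode x) (map_pmf encode (f x))"
    using assms(2) unfolding ppt_iff_computes by blast
  obtain q U where q: "\<And>y. computes q U (encode y) (map_pmf encode (g y))"
    using assms(3) unfolding ppt_iff_computes by blast
  have "computes (Cond r p q) ([:1, 1:] + R + (T + U)) (encode x)
      (map_pmf encode (if b x then f x else g x))" for x
    using computes_add_left[OF p] computes_add_right[OF q]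
    by (intro computes_Cond[OF r]) (auto simp: encode_bool_def)
  then show ?thesis by (rule pptI)
qed

lemma poly_time_is_Leaf: "poly_time (\<lambda>x. x \<noteq> Leaf)"
proof -
  obtain p T where p: "\<And>x. computes p T x (return_pmf (Node Leaf Leaf))"
    using computes_constant by blast
  have "computes (Cond Ident p Nul) ([:1, 1:] + [:1, 1:] + (T + 1)) (encode x)
      (return_pmf (encode (x \<noteq> Leaf)))" for x :: tree
    using computes_add_left[OF p] computes_add_right[OF computes_Nul]
    by (intro computes_Cond[OF computes_Ident]) (auto simp: encode_tree_def encode_bool_def)
  then show ?thesis by (rule poly_timeI)
qed

text \<open>In the encoding of a pair whose second component is a sum, the tag sits at
  \<open>head (tail _)\<close> and is \<open>Leaf\<close> exactly for \<open>Inl\<close>. Deleting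
  the tag leaves the encoding of the pair expected by the branch. Since \<open>Cond\<close> takes
  its first branch on a tag other than \<open>Leaf\<close>, the program for \<open>Inr\<close> comes
  first.\<close>

lemma ppt_case_sum:
  assumes "ppt (\<lambda>p. f (fst p) (snd p))" and "ppt (\<lambda>p. g (fst p) (snd p))"
  shows "ppt (\<lambda>p. case snd p of Inl a \<Rightarrow> f (fst p) a | Inr b \<Rightarrow> g (fst p) b)"
proof -
  obtain p T where p: "\<And>x y. computes p T (encode (x, y)) (map_pmf encode (f x y))"
    using assms(1) unfolding ppt_iff_computes by (metis fst_conv snd_conv)
  obtain q U where q: "\<And>x y. computes q U (encode (x, y)) (map_pmf encode (g x y))"
    using assms(2) unfolding ppt_iff_computes by (metis fst_conv snd_conv)
  have tag: "computes (Then Tail Head) ([:1, 1:] + pcompose [:1, 1:] [:1, 1:]) x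
      (return_pmf (head (tail x)))" for x
    using computes_Then[OF computes_Tail computes_Head] by (simp add: bind_return_pmf)
  define strip where "strip = Fork Head (Then Tail Tail)"
  obtain S where strip: "\<And>x. computes strip S x (return_pmf (Node (head x) (tail (tail x))))"
  proof
    have 1: "computes (Then Tail Tail) ([:1, 1:] + pcompose [:1, 1:] [:1, 1:]) x
      (return_pmf (tail (tail x)))" for x
      using computes_Then[OF computes_Tail computes_Tail] by (simp add: bind_return_pmf)
    show "computes strip ([:1, 1:] + [:1, 1:] + ([:1, 1:] + pcompose [:1, 1:] [:1, 1:])) x
        (return_pmf (Node (head x) (tail (tail x))))" for x
      using computes_Fork[OF computes_Head 1] unfolding strip_def by (simp add: bind_return_pmf)
  qed
  have branch: "computes (Then strip s) (S + pcompose V S) x h"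
    if "computes s V (Node (head x) (tail (tail x))) h" for s V x h
    using computes_Then[OF strip, of x s V "\<lambda>_. h"] that by (simp add: bind_return_pmf)
  show ?thesis
  proof (rule pptI)
    fix x :: "'a \<times> ('b + 'd)"
    obtain c y where x: "x = (c, y)" by (cases x)
    show "computes (Cond (Then Tail Head) (Then strip q) (Then strip p))
      ([:1, 1:] + ([:1, 1:] + pcompose [:1, 1:] [:1, 1:]) + ((S + pcompose T S) + (S + pcompose U S)))
      (encode x) (map_pmf encode (case snd x of Inl a \<Rightarrow> f (fst x) a | Inr b \<Rightarrow> g (fst x) b))"
    proof (rule computes_Cond[OF tag], cases y)
      case (Inl a)
      show "computes (if head (tail (encode x)) \<noteq> Leaf then Then strip q else Then strip p)
          (S + pcompose T S + (S + pcompose U S)) (encode x)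
          (map_pmf encode (case snd x of Inl a \<Rightarrow> f (fst x) a | Inr b \<Rightarrow> g (fst x) b))"
        using computes_add_left[OF branch, of p T "encode x"] p[of c a]
        by (simp add: x Inl encode_prod_def encode_sum_def)
    next
      case (Inr b)
      show "computes (if head (tail (encode x)) \<noteq> Leaf then Then strip q else Then strip p)
          (S + pcompose T S + (S + pcompose U S)) (encode x)
          (map_pmf encode (case snd x of Inl a \<Rightarrow> f (fst x) a | Inr b \<Rightarrow> g (fst x) b))"
        using computes_add_right[OF branch, of q U "encode x"] q[of c b]
        by (simp add: x Inr encode_prod_def encode_sum_def)
    qed
  qed
qed

section \<open>Decoding unary numbers from arbitrary trees\<close>

primrec spine :: "tree \<Rightarrow> nat" where
  "spine Leaf = 0" | "spine (Node a b) = Suc (spine b)"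

lemma spine_encode [simp]: "spine (encode (n :: nat)) = n"
  by (induction n) auto

lemma size_encode_nat [simp]: "size (encode (n :: nat)) = n"
  by (induction n) auto

text \<open>The loop keeps \<open>Node (encode m) x\<close>, where \<open>m\<close> counts the nodes of the right spine removed so far
  and \<open>x\<close> is the rest.\<close>

definition spine_step :: prog where
  "spine_step = Fork (Fork Nul Head) (Then Tail Tail)"

text \<open>This and the next two rules follow deterministic runs as point masses with their exact
  times, which the induction over the loop has to add up.\<close>

lemma exec_return_Then: "exec p x (return_pmf (y, t)) \<Longrightarrow> exec q y (return_pmf (z, u)) \<Longrightarrow>
    exec (Then p q) x (return_pmf (z, t + u))"
  using exec.Then[of p x "return_pmf (y, t)" q "\<lambda>_. return_pmf (z, u)"]
  by (simp add: bind_return_pmf)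

lemma exec_return_Fork: "exec p x (return_pmf (y, t)) \<Longrightarrow> exec q x (return_pmf (z, u)) \<Longrightarrow>
    exec (Fork p q) x (return_pmf (Node y z, Suc (size x + t + u)))"
  using exec.Fork[of p x "return_pmf (y, t)" q "return_pmf (z, u)"]
  by (simp add: bind_return_pmf)

lemma exec_return_Cond: "exec b x (return_pmf (v, t)) \<Longrightarrow>
    exec (if v \<noteq> Leaf then p else q) x (return_pmf (z, u)) \<Longrightarrow>
    exec (Cond b p q) x (return_pmf (z, Suc (size x + t + u)))"
  using exec.Cond[of b x "return_pmf (v, t)" p q "\<lambda>_. return_pmf (z, u)"]
  by (simp add: bind_return_pmf)

text \<open>The test \<open>Tail\<close> reads the rest \<open>x\<close>, so the loop stops at
  \<open>Leaf\<close>. A round moves at least one node out of the rest and adds one to the counter,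
  so \<open>m + size x\<close> never grows. Each round costs time linear in this quantity, and there
  are at most \<open>size x\<close> rounds before the final test.\<close>

lemma exec_spine_loop:
  "\<exists>t. exec (While Tail spine_step) (Node (encode m) x)
     (return_pmf (Node (encode (m + spine x)) Leaf, t)) \<and>
     t \<le> (size x + 1) * (10 * (m + size x) + 20)"
proof (induction x arbitrary: m)
  case Leaf
  have "exec (Cond Tail (Then spine_step (While Tail spine_step)) Ident) (Node (encode m) Leaf)
     (return_pmf (Node (encode m) Leaf, Suc (Suc m + Suc (Suc m) + Suc (Suc m))))"
    using exec_return_Cond[OF exec.Tail[of "Node (encode m) Leaf"],
      of "Then spine_step (While Tail spine_step)" Ident "Node (encode m) Leaf" "Suc (Suc m)"]
      exec.Ident[of "Node (encode m) Leaf"]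
    by simp
  from exec.While[OF this] show ?case by force
next
  case (Node a b)
  let ?x = "Node (encode m) (Node a b)"
  obtain t where t: "exec (While Tail spine_step) (Node (encode (Suc m)) b)
      (return_pmf (Node (encode (Suc m + spine b)) Leaf, t))"
    and tb: "t \<le> (size b + 1) * (10 * (Suc m + size b) + 20)"
    using Node.IH(2)[of "Suc m"] by blast
  have step: "exec spine_step ?x (return_pmf (Node (encode (Suc m)) b,
     Suc (size ?x + Suc (size ?x + 1 + Suc (size ?x)) + (Suc (size ?x) + Suc (Suc (size a + size b))))))"
    unfolding spine_step_def
    using exec_return_Fork[OF exec_return_Fork[OF exec.Nul exec.Head, of ?x]
       exec_return_Then[OF exec.Tail[of ?x] exec.Tail]]
    by simp
  obtain u where "exec (Cond Tail (Then spine_step (While Tail spine_step)) Ident) ?x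
      (return_pmf (Node (encode (Suc m + spine b)) Leaf, u))"
    and u: "u = Suc (size ?x + Suc (size ?x) + (Suc (size ?x + Suc (size ?x + 1 + Suc (size ?x)) + (Suc (size ?x) + Suc (Suc (size a + size b)))) + t))"
    using exec_return_Cond[OF exec.Tail[of ?x], of "Then spine_step (While Tail spine_step)",
      simplified, OF exec_return_Then[OF step t]] by simp
  from exec.While[OF this(1)]
  have "exec (While Tail spine_step) ?x (return_pmf (Node (encode (m + spine (Node a b))) Leaf, u))"
    by simp
  moreover have "u \<le> (size (Node a b) + 1) * (10 * (m + size (Node a b)) + 20)"
  proof -
    have "u \<le> 10 * (m + size (Node a b)) + 20 + t"
      unfolding u by simp
    also have "t \<le> (size b + 1) * (10 * (m + size (Node a b)) + 20)"
      by (rule order.trans[OF tb]) (intro mult_left_mono, auto)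
    finally have "u \<le> (size b + 2) * (10 * (m + size (Node a b)) + 20)" by simp
    also have "\<dots> \<le> (size (Node a b) + 1) * (10 * (m + size (Node a b)) + 20)"
      by (intro mult_right_mono) auto
    finally show ?thesis .
  qed
  ultimately show ?case by blast
qed

lemma poly_time_spine: "poly_time spine"
proof -
  have loop: "computes (While Tail spine_step) ([:1, 1:] * [:20, 10:]) (Node Leaf x)
      (return_pmf (Node (encode (spine x)) Leaf))" for x
  proof -
    obtain t where t: "exec (While Tail spine_step) (Node Leaf x)
        (return_pmf (Node (encode (spine x)) Leaf, t))"
      and "t \<le> (size x + 1) * (10 * size x + 20)"
      using exec_spine_loop[of 0 x] by auto
    \<comment> \<open>The bound must be a polynomial in the size of the whole loop input
      \<open>Node Leaf x\<close>, which exceeds \<open>size x\<close> by one.\<close>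
    moreover have "(size x + 1) * (10 * size x + 20) \<le> (size x + 2) * (10 * (size x + 1) + 20)"
      by (intro mult_mono) auto
    ultimately show ?thesis
      unfolding computes_def by (intro exI[of _ "return_pmf (Node (encode (spine x)) Leaf, t)"]) (auto simp: algebra_simps)
  qed
  have init: "computes (Fork Nul Ident) ([:1, 1:] + 1 + [:1, 1:]) x (return_pmf (Node Leaf x))" for x
    using computes_Fork[OF computes_Nul computes_Ident] by (simp add: bind_return_pmf)
  have "computes (Then (Fork Nul Ident) (While Tail spine_step))
      (([:1, 1:] + 1 + [:1, 1:]) + pcompose ([:1, 1:] * [:20, 10:]) ([:1, 1:] + 1 + [:1, 1:])) x
      (return_pmf (Node (encode (spine x)) Leaf))" for x
    using computes_Then[OF init, of x _ _ "\<lambda>y. return_pmf (Node (encode (spine (tail y))) Leaf)"]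
      loop[of x]
    unfolding bind_return_pmf tail.simps by simp
  from computes_Then[OF this computes_Head]
  show ?thesis
    by (intro poly_timeI) (simp only: bind_return_pmf head.simps encode_tree_def)
qed

section \<open>Simulating an adversary\<close>

text \<open>The wrapped adversary runs \<open>B\<close> and finally computes its output bit with \<open>F\<close>. Its state is
  \<open>(\<rho>, pms, mpk, s)\<close>, where \<open>Leaf\<close> stands for the still unknown key and \<open>s\<close> is the state of \<open>B\<close>.
  Polynomial time is demanded on all trees, also on those that encode no such state; this is why
  \<open>\<rho>\<close> is read off with \<open>spine\<close>. A stored key is \<open>encode (Some mpk)\<close>, hence the \<open>tail\<close> below.\<close>

definition stored_key :: "tree \<times> tree option \<Rightarrow> tree" where
  "stored_key x = (if head (tail (tail (fst x))) \<noteq> Leaf then head (tail (tail (fst x))) else encode (snd x))"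

definition wrap :: "(tree, 'z) adversary_scheme \<Rightarrow>
    (nat \<Rightarrow> tree \<Rightarrow> tree \<Rightarrow> ident \<Rightarrow> tree \<Rightarrow> bool pmf) \<Rightarrow> bool adversary" where
  "wrap B F = \<lparr>queries = queries B,
     commit = \<lambda>x. map_pmf (\<lambda>y. (fst y, encode (fst x, snd x, Leaf, snd y))) (commit B x),
     act = \<lambda>x. bind_pmf (act B (tail (tail (tail (fst x))), snd x)) (\<lambda>a. case a of
         Inl q \<Rightarrow> return_pmf (Inl (fst q, encode (spine (head (fst x)), head (tail (fst x)),
                    stored_key x, snd q)))
       | Inr q \<Rightarrow> map_pmf (\<lambda>d. Inr (fst q, d)) (F (spine (head (fst x))) (head (tail (fst x)))
                    (tail (stored_key x)) (fst q) (snd q)))\<rparr>"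

lemma queries_wrap [simp]: "queries (wrap B F) = queries B"
  by (simp add: wrap_def)

lemma commit_wrap: "commit (wrap B F) (\<rho>, pms) =
    map_pmf (\<lambda>(idd, st). (idd, encode (\<rho>, pms, Leaf, st))) (commit B (\<rho>, pms))"
  by (simp add: wrap_def case_prod_beta')

lemma act_wrap: "act (wrap B F) (encode (\<rho>, pms, key, st), msg) =
    bind_pmf (act B (st, msg)) (\<lambda>a. case a of
      Inl (r, s) \<Rightarrow> return_pmf (Inl (r, encode (\<rho>, pms, if key \<noteq> Leaf then key else encode msg, s)))
    | Inr (ids, s) \<Rightarrow> map_pmf (\<lambda>d. Inr (ids, d))
        (F \<rho> pms (tail (if key \<noteq> Leaf then key else encode msg)) ids s))"
  by (simp add: wrap_def stored_key_def encode_prod_def encode_tree_def case_prod_beta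
      cong: sum.case_cong)

lemma Inl_act_wrapD:
  assumes "Inl (r, st') \<in> set_pmf (act (wrap B F) (encode (\<rho> :: nat, pms :: tree, key :: tree, st :: tree), msg))"
  shows "\<exists>s. Inl (r, s) \<in> set_pmf (act B (st, msg)) \<and>
    st' = encode (\<rho>, pms, if key \<noteq> Leaf then key else encode msg, s)"
proof -
  obtain a where "a \<in> set_pmf (act B (st, msg))"
    and "Inl (r, st') \<in> set_pmf (case a of
      Inl (r, s) \<Rightarrow> return_pmf (Inl (r, encode (\<rho>, pms, if key \<noteq> Leaf then key else encode msg, s)))
    | Inr (ids, s) \<Rightarrow> map_pmf (\<lambda>d. Inr (ids, d))
        (F \<rho> pms (tail (if key \<noteq> Leaf then key else encode msg)) ids s))"
    using assms unfolding act_wrap by auto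
  then show ?thesis by (cases a) auto
qed

lemma Inr_act_wrapD:
  assumes "Inr (ids, d) \<in> set_pmf (act (wrap B F) (encode (\<rho> :: nat, pms :: tree, key :: tree, st :: tree), msg))"
  shows "\<exists>s. Inr (ids, s) \<in> set_pmf (act B (st, msg))"
proof -
  obtain a where "a \<in> set_pmf (act B (st, msg))"
    and "Inr (ids, d) \<in> set_pmf (case a of
      Inl (r, s) \<Rightarrow> return_pmf (Inl (r, encode (\<rho>, pms, if key \<noteq> Leaf then key else encode msg, s)))
    | Inr (ids, s) \<Rightarrow> map_pmf (\<lambda>d. Inr (ids, d))
        (F \<rho> pms (tail (if key \<noteq> Leaf then key else encode msg)) ids s))"
    using assms unfolding act_wrap by auto
  then show ?thesis by (cases a) auto
qed

section \<open>Efficiency and legality of the simulation\<close>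

lemmas poly_time_intros = poly_time_id poly_time_const poly_time_Pair poly_time_fst poly_time_snd
  ppt_comp[OF poly_time_encode] ppt_comp[OF poly_time_head] ppt_comp[OF poly_time_tail]
  ppt_comp[OF poly_time_spine]

lemma poly_time_Inl: "poly_time (Inl :: 'a::encodable \<Rightarrow> 'a + 'b::encodable)"
proof -
  obtain p T where p: "\<And>x. computes p T x (return_pmf Leaf)"
    using computes_constant by blast
  show ?thesis
    using computes_Fork[OF p computes_Ident]
    by (intro poly_timeI[of "Fork p Ident" "[:1, 1:] + T + [:1, 1:]"])
      (simp only: bind_return_pmf encode_sum_def map_return_pmf sum.case)
qed

lemma poly_time_Inr: "poly_time (Inr :: 'b::encodable \<Rightarrow> 'a::encodable + 'b)"
proof -
  obtain p T where p: "\<And>x. computes p T x (return_pmf (Node Leaf Leaf))"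
    using computes_constant by blast
  show ?thesis
    using computes_Fork[OF p computes_Ident]
    by (intro poly_timeI[of "Fork p Ident" "[:1, 1:] + T + [:1, 1:]"])
      (simp only: bind_return_pmf encode_sum_def map_return_pmf sum.case)
qed

lemma poly_time_stored_key: "poly_time stored_key"
proof -
  have "poly_time (\<lambda>x :: tree \<times> tree option. head (tail (tail (fst x))) \<noteq> Leaf)"
    by (intro ppt_comp[OF poly_time_is_Leaf] poly_time_intros)
  then have "ppt (\<lambda>x :: tree \<times> tree option. if head (tail (tail (fst x))) \<noteq> Leaf
      then return_pmf (head (tail (tail (fst x)))) else return_pmf (encode (snd x)))"
    by (rule ppt_if) (intro poly_time_intros)+
  then show ?thesis by (simp add: stored_key_def[abs_def] if_distrib[of return_pmf])
qed

lemma ppt_commit_wrap: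
  assumes "ppt (commit B)"
  shows "ppt (commit (wrap B F))"
  unfolding wrap_def adversary.simps map_pmf_def
  by (rule ppt_bind[OF assms]) (intro poly_time_intros)

lemma ppt_act_wrap:
  assumes "ppt (act B)" and "ppt (\<lambda>(\<rho>, pms, mpk, u, st). F \<rho> pms mpk u st)"
  shows "ppt (act (wrap B F))"
  unfolding wrap_def adversary.simps map_pmf_def
proof (rule ppt_bind)
  show "ppt (\<lambda>x. act B (tail (tail (tail (fst x))), snd x))"
    by (intro ppt_comp[OF assms(1)] poly_time_intros)
  show "ppt (\<lambda>p. case snd p of
      Inl q \<Rightarrow> return_pmf (Inl (fst q, encode (spine (head (fst (fst p))),
        head (tail (fst (fst p))), stored_key (fst p), snd q)))
    | Inr q \<Rightarrow> bind_pmf (F (spine (head (fst (fst p)))) (head (tail (fst (fst p))))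
        (tail (stored_key (fst p))) (fst q) (snd q)) (\<lambda>d. return_pmf (Inr (fst q, d))))"
  proof (rule ppt_case_sum)
    show "ppt (\<lambda>p. return_pmf (Inl (fst (snd p), encode (spine (head (fst (fst p))),
        head (tail (fst (fst p))), stored_key (fst p), snd (snd p)))))"
      by (intro ppt_comp[OF poly_time_Inl] poly_time_intros ppt_comp[OF poly_time_stored_key])
    have "poly_time (\<lambda>p :: (tree \<times> tree option) \<times> (ident \<times> tree).
        (spine (head (fst (fst p))), head (tail (fst (fst p))),
         tail (stored_key (fst p)), fst (snd p), snd (snd p)))"
      by (intro poly_time_intros ppt_comp[OF poly_time_stored_key])
    from ppt_comp[OF assms(2) this]
    have "ppt (\<lambda>p. F (spine (head (fst (fst p)))) (head (tail (fst (fst p))))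
        (tail (stored_key (fst p))) (fst (snd p)) (snd (snd p)))"
      unfolding prod.case .
    then show "ppt (\<lambda>p. bind_pmf (F (spine (head (fst (fst p)))) (head (tail (fst (fst p))))
        (tail (stored_key (fst p))) (fst (snd p)) (snd (snd p)))
        (\<lambda>d. return_pmf (Inr (fst (snd p), d))))"
      by (rule ppt_bind) (intro ppt_comp[OF poly_time_Inr] poly_time_intros)
  qed
qed

text \<open>Invariant of a simulated run. As long as no key is stored, the pending message is the
  very first one, hence a master public key; so what gets stored is
  \<open>encode (Some mpk)\<close>, one node larger than \<open>mpk\<close>. The size bounds control
  what the wrapper adds to the state of \<open>B\<close>.\<close>

lemma reach_wrap:
  assumes "reach (wrap B F) \<rho> pms idd QS IS k len st msg"
  shows "\<exists>key s :: tree. st = encode (\<rho>, pms, key, s) \<and> reach B \<rho> pms idd QS IS k len s msg \<and>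
     (key = Leaf \<longrightarrow> (\<exists>mpk. msg = Some mpk \<and> size mpk \<le> len)) \<and> size key \<le> len + 1 \<and> size pms \<le> len"
  using assms
proof induction
  case (start idd st mpk)
  then obtain s where "(idd, s) \<in> set_pmf (commit B (\<rho>, pms))" "st = encode (\<rho>, pms, Leaf, s)"
    by (auto simp: commit_wrap)
  then show ?case using reach.start[of idd s B \<rho> pms mpk] by fastforce
next
  case (query idd QS IS k len st msg r st' msg')
  then obtain key s :: tree where s: "st = encode (\<rho>, pms, key, s)" "reach B \<rho> pms idd QS IS k len s msg"
    and key: "key = Leaf \<longrightarrow> (\<exists>mpk. msg = Some mpk \<and> size mpk \<le> len)" "size key \<le> len + 1"
    "size pms \<le> len" by blast
  define key' where "key' = (if key \<noteq> Leaf then key else encode msg)"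
  obtain s' where s': "Inl (r, s') \<in> set_pmf (act B (s, msg))" "st' = encode (\<rho>, pms, key', s')"
    using Inl_act_wrapD[OF query.hyps(2)[unfolded s(1)]] unfolding key'_def by blast
  have "key' \<noteq> Leaf" "size key' \<le> len + 1"
    using key by (auto simp: key'_def encode_option_def encode_tree_def)
  then show ?case using reach.query[OF s(2) s'(1), of msg'] s'(2) key(3) by fastforce
qed

lemma ppt_adversary_wrap:
  assumes "ppt_adversary B" and "ppt (\<lambda>(\<rho>, pms, mpk, u, st). F \<rho> pms mpk u st)"
  shows "ppt_adversary (wrap B F)"
proof -
  obtain S where S: "\<And>\<rho> pms idd QS IS k len st msg. reach B \<rho> pms idd QS IS k len st msg \<Longrightarrow>
        size st \<le> poly S (\<rho> + len)"
    using assms(1) unfolding ppt_adversary_def by blast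
  \<comment> \<open>Three pairing nodes, \<rho>, \<open>pms\<close> of size at most
    \<open>len\<close> and a key of size at most \<open>len + 1\<close> are covered by
    \<open>[:4, 3:]\<close>.\<close>
  have "size st \<le> poly ([:4, 3:] + S) (\<rho> + len)"
    if r: "reach (wrap B F) \<rho> pms idd QS IS k len st msg" for \<rho> pms idd QS IS k len st msg
  proof -
    obtain key s :: tree where "st = encode (\<rho>, pms, key, s)" "reach B \<rho> pms idd QS IS k len s msg"
      "size key \<le> len + 1" "size pms \<le> len"
      using reach_wrap[OF r] by blast
    then show ?thesis using S[of \<rho> pms idd QS IS k len s msg]
      by (simp add: encode_prod_def encode_tree_def)
  qed
  moreover have "k \<le> queries B \<rho>"
    if r: "reach (wrap B F) \<rho> pms idd QS IS k len st msg" for \<rho> pms idd QS IS k len st msg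
    using reach_wrap[OF r] assms(1) unfolding ppt_adversary_def by blast
  ultimately show ?thesis
    using assms ppt_commit_wrap[of B F] ppt_act_wrap[of B F]
    unfolding ppt_adversary_def queries_wrap by blast
qed

text \<open>Requests and challenge identity of \<open>B\<close> are passed on unchanged;
  \<open>F\<close> influences only the final bit.\<close>

lemma legal_wrap:
  assumes "legal sec S Ids B"
  shows "legal sec S Ids (wrap B F)"
  unfolding legal_def
proof (intro allI ballI conjI impI)
  fix \<rho> pms assume pms: "pms \<in> set_pmf (S \<rho>)"
  show "case x of (idd, st) \<Rightarrow> idd \<in> Ids pms" if "x \<in> set_pmf (commit (wrap B F) (\<rho>, pms))" for x
    using that assms pms unfolding legal_def by (fastforce simp: commit_wrap)
  fix idd QS IS k len st msg assume "reach (wrap B F) \<rho> pms idd QS IS k len st msg"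
  then obtain key s :: tree where s: "st = encode (\<rho>, pms, key, s)" "reach B \<rho> pms idd QS IS k len s msg"
    using reach_wrap by blast
  show "legal_request sec (Ids pms) idd QS r" if a: "Inl (r, st') \<in> set_pmf (act (wrap B F) (st, msg))"
    for r st'
  proof -
    obtain s' where "Inl (r, s') \<in> set_pmf (act B (s, msg))"
      using Inl_act_wrapD[OF a[unfolded s(1)]] by blast
    then show ?thesis using assms pms s(2) unfolding legal_def by blast
  qed
  show "legal_challenge sec (Ids pms) idd IS ids"
    if a: "Inr (ids, out) \<in> set_pmf (act (wrap B F) (st, msg))" for ids out
  proof -
    obtain s' where "Inr (ids, s') \<in> set_pmf (act B (s, msg))"
      using Inr_act_wrapD[OF a[unfolded s(1)]] by blast
    then show ?thesis using assms pms s(2) unfolding legal_def by blast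
  qed
qed

section \<open>Separating the final bit from the interaction\<close>

definition finish :: "(ident \<Rightarrow> tree \<Rightarrow> bool pmf) \<Rightarrow> (ident \<times> tree \<times> ident list) option \<Rightarrow>
    (ident \<times> bool \<times> ident list) option pmf" where
  "finish G res = (case res of None \<Rightarrow> return_pmf None
     | Some (ids, s, IS) \<Rightarrow> map_pmf (\<lambda>d. Some (ids, d, IS)) (G ids s))"

text \<open>A stored key never changes, so the induction runs with \<open>key\<close> fixed, and
  \<open>F\<close> can be postponed until the interaction of \<open>B\<close> is over.\<close>

lemma interact_wrap_stored:
  assumes "key \<noteq> Leaf"
  shows "interact k (act (wrap B F)) kg del keys IS (encode (\<rho>, pms, key, st)) msg =
    bind_pmf (interact k (act B) kg del keys IS st msg) (finish (F \<rho> pms (tail key)))"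
proof (induction k arbitrary: keys IS st msg)
  case 0
  show ?case
    unfolding interact.simps act_wrap bind_assoc_pmf using assms
    by (intro bind_pmf_cong refl)
      (auto simp: finish_def bind_return_pmf map_pmf_def bind_assoc_pmf split: sum.splits)
next
  case (Suc k)
  show ?case
    unfolding interact.simps act_wrap bind_assoc_pmf using assms
    by (intro bind_pmf_cong refl)
      (auto simp: bind_return_pmf map_pmf_def bind_assoc_pmf Suc.IH case_prod_beta' finish_def[of _ "Some _"]
        split: sum.splits)
qed

text \<open>The first activation treats the pending message as the key. It therefore acts as if
  \<open>encode (Some mpk)\<close> had been stored from the start, which reduces the claim to the
  case of a stored key.\<close>

lemma interact_wrap:
  "interact k (act (wrap B F)) kg del keys IS (encode (\<rho>, pms, Leaf, st)) (Some mpk) =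
    bind_pmf (interact k (act B) kg del keys IS st (Some mpk)) (finish (F \<rho> pms mpk))"
proof -
  let ?key = "encode (Some mpk)"
  have key: "?key \<noteq> Leaf" "tail ?key = mpk" by (auto simp: encode_option_def encode_tree_def)
  have "act (wrap B F) (encode (\<rho>, pms, Leaf, st), Some mpk) =
      act (wrap B F) (encode (\<rho>, pms, ?key, st), Some mpk)"
    unfolding act_wrap using key(1) by simp
  then have "interact k (act (wrap B F)) kg del keys IS (encode (\<rho>, pms, Leaf, st)) (Some mpk) =
      interact k (act (wrap B F)) kg del keys IS (encode (\<rho>, pms, ?key, st)) (Some mpk)"
    by (cases k) simp_all
  also have "\<dots> = bind_pmf (interact k (act B) kg del keys IS st (Some mpk)) (finish (F \<rho> pms mpk))"
    unfolding interact_wrap_stored[OF key(1)] key(2) ..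
  finally show ?thesis .
qed

text \<open>A query made after the budget is spent would lead to a reachable situation with
  \<open>q + 1\<close> queries, against the bound. Reachability allows any answer to that query, so
  \<open>None\<close> serves as the answer.\<close>

lemma interact_not_None:
  assumes bound: "\<And>QS IS k len st msg. reach A \<rho> pms idd QS IS k len st msg \<Longrightarrow> k \<le> q"
    and "reach A \<rho> pms idd QS IS j len st msg" and "j + k = q"
  shows "None \<notin> set_pmf (interact k (act A) kg del keys L st msg)"
  using assms(2,3)
proof (induction k arbitrary: QS IS j len keys L st msg)
  case 0
  have "Inl (r, st') \<notin> set_pmf (act A (st, msg))" for r st'
    using bound[OF reach.query[OF 0(1), of r st' None]] 0(2) by auto
  then show ?case by (auto split: sum.splits)
next
  case (Suc k)
  have "None \<notin> set_pmf (interact k (act A) kg del keys' L' st' msg')"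
    if "Inl (r, st') \<in> set_pmf (act A (st, msg))" for r st' msg' keys' L'
    using Suc.IH[OF reach.query[OF Suc.prems(1) that]] Suc.prems(2) by simp
  then show ?case by (auto split: sum.splits)
qed

section \<open>Leftover hash lemma\<close>

text \<open>For \<open>X\<close> supported on \<open>D\<close>, the probability that two independent
  samples collide. The form as a finite double sum can be exchanged with the expectation over hash
  keys.\<close>

definition collision_prob :: "'a set \<Rightarrow> ('a \<Rightarrow> 'b) \<Rightarrow> 'a pmf \<Rightarrow> real" where
  "collision_prob D h X = (\<Sum>x\<in>D. \<Sum>x'\<in>D. pmf X x * pmf X x' * of_bool (h x = h x'))"

lemma expectation_image:
  fixes g :: "'b \<Rightarrow> real"
  assumes "finite D" "set_pmf X \<subseteq> D"
  shows "measure_pmf.expectation X (\<lambda>x. g (h x)) = (\<Sum>y\<in>h ` D. g y * pmf (map_pmf h X) y)"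
proof -
  have "measure_pmf.expectation X (\<lambda>x. g (h x)) = measure_pmf.expectation (map_pmf h X) g" by simp
  also have "\<dots> = (\<Sum>y\<in>h ` D. g y * pmf (map_pmf h X) y)"
    using assms by (intro integral_measure_pmf_real) auto
  finally show ?thesis .
qed

text \<open>The squared Euclidean norm of the image distribution sums, over all values, the
  probability that two independent samples both hit that value.\<close>

lemma sum_power2_map_pmf:
  assumes D: "finite D" "set_pmf X \<subseteq> D"
  shows "(\<Sum>y\<in>h ` D. (pmf (map_pmf h X) y)\<^sup>2) = collision_prob D h X"
proof -
  have 1: "pmf (map_pmf h X) y = (\<Sum>x\<in>D. pmf X x * of_bool (h x = y))" for y
  proof -
    have "pmf (map_pmf h X) y = measure_pmf.expectation X (indicator (h -` {y}))"
      by (simp add: pmf_map)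
    also have "\<dots> = (\<Sum>x\<in>D. indicator (h -` {y}) x * pmf X x)"
      using D by (intro integral_measure_pmf_real) auto
    also have "\<dots> = (\<Sum>x\<in>D. pmf X x * of_bool (h x = y))"
      by (intro sum.cong) (auto simp: indicator_def)
    finally show ?thesis .
  qed
  have "(\<Sum>y\<in>h ` D. (pmf (map_pmf h X) y)\<^sup>2) =
    (\<Sum>y\<in>h ` D. \<Sum>x\<in>D. \<Sum>x'\<in>D. pmf X x * pmf X x' * (of_bool (h x = y) * of_bool (h x' = y)))"
    unfolding 1 power2_eq_square sum_product by (simp add: mult_ac)
  also have "\<dots> = (\<Sum>x\<in>D. \<Sum>x'\<in>D. \<Sum>y\<in>h ` D. pmf X x * pmf X x' * (of_bool (h x = y) * of_bool (h x' = y)))"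
    by (subst sum.swap, rule sum.cong[OF refl], subst sum.swap, rule refl)
  also have "\<dots> = collision_prob D h X"
    unfolding collision_prob_def sum_distrib_left[symmetric]
  proof (intro sum.cong refl)
    fix x x' assume "x \<in> D" "x' \<in> D"
    have "(\<Sum>y\<in>h ` D. of_bool (h x = y) * of_bool (h x' = y)) =
        (\<Sum>y\<in>h ` D. if y = h x then of_bool (h x = h x') else (0 :: real))"
      by (intro sum.cong) auto
    also have "\<dots> = of_bool (h x = h x')"
      using D(1) \<open>x \<in> D\<close> by (simp add: sum.delta)
    finally show "pmf X x * pmf X x' * (\<Sum>y\<in>h ` D. of_bool (h x = y) * of_bool (h x' = y)) =
        pmf X x * pmf X x' * of_bool (h x = h x')" by simp
  qed
  finally show ?thesis .
qed

text \<open>After expanding the square, the cross term is known because the probabilities sum to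
  one. So the excess of the collision probability over its least possible value is the squared
  distance from the uniform distribution on the image.\<close>

lemma sum_power2_deviation:
  assumes D: "finite D" "set_pmf X \<subseteq> D"
  shows "(\<Sum>y\<in>h ` D. (pmf (map_pmf h X) y - 1 / card (h ` D))\<^sup>2) =
    collision_prob D h X - 1 / card (h ` D)"
proof -
  let ?I = "h ` D" let ?q = "pmf (map_pmf h X)" let ?R = "real (card ?I)"
  have "D \<noteq> {}" using D(2) set_pmf_not_empty[of X] by auto
  then have R: "?R \<noteq> 0" using D(1) by simp
  have 1: "sum ?q ?I = 1" using D by (intro sum_pmf_eq_1) auto
  have "(\<Sum>y\<in>?I. (?q y - 1 / ?R)\<^sup>2) = (\<Sum>y\<in>?I. (?q y)\<^sup>2) - 2 / ?R * sum ?q ?I + ?R * (1 / ?R)\<^sup>2"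
    by (simp add: power2_diff sum.distrib sum_subtractf sum_distrib_left)
  then show ?thesis
    using R unfolding 1 sum_power2_map_pmf[OF D] by (simp add: power2_eq_square)
qed

lemma collision_prob_ge:
  assumes "finite D" "set_pmf X \<subseteq> D"
  shows "1 / card (h ` D) \<le> collision_prob D h X"
  using sum_power2_deviation[OF assms, of h]
    sum_nonneg[of "h ` D" "\<lambda>y. (pmf (map_pmf h X) y - 1 / card (h ` D))\<^sup>2"] by simp

lemma collision_prob_le_1:
  assumes "finite D" "set_pmf X \<subseteq> D"
  shows "collision_prob D h X \<le> 1"
proof -
  have "collision_prob D h X \<le> (\<Sum>x\<in>D. \<Sum>x'\<in>D. pmf X x * pmf X x')"
    unfolding collision_prob_def by (intro sum_mono) auto
  also have "\<dots> = 1"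
    unfolding sum_product[symmetric] using assms by (simp add: sum_pmf_eq_1)
  finally show ?thesis .
qed

text \<open>Cauchy-Schwarz over the image yields the factor \<open>R\<close>, since \<open>g\<close>
  takes values between 0 and 1. The distance between the two image distributions is then split at
  the uniform distribution, which costs the factor 2.\<close>

lemma distinguish_le_collision_prob:
  fixes g :: "'b \<Rightarrow> real" and h :: "'a \<Rightarrow> 'b"
  assumes D: "finite D" "set_pmf X \<subseteq> D" "set_pmf Y \<subseteq> D" and g: "\<And>y. 0 \<le> g y" "\<And>y. g y \<le> 1"
  defines "R \<equiv> real (card (h ` D))"
  shows "(measure_pmf.expectation X (\<lambda>x. g (h x)) - measure_pmf.expectation Y (\<lambda>x. g (h x)))\<^sup>2 \<le>
    2 * R * ((collision_prob D h X - 1 / R) + (collision_prob D h Y - 1 / R))"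
proof -
  let ?I = "h ` D" let ?p = "pmf (map_pmf h X)" let ?q = "pmf (map_pmf h Y)"
  have "(measure_pmf.expectation X (\<lambda>x. g (h x)) - measure_pmf.expectation Y (\<lambda>x. g (h x)))\<^sup>2 =
      (\<Sum>y\<in>?I. g y * (?p y - ?q y))\<^sup>2"
    by (simp add: expectation_image[OF D(1)] D(2,3) right_diff_distrib sum_subtractf)
  also have "\<dots> \<le> (\<Sum>y\<in>?I. (g y)\<^sup>2) * (\<Sum>y\<in>?I. (?p y - ?q y)\<^sup>2)"
    by (rule Cauchy_Schwarz_ineq_sum)
  also have "\<dots> \<le> R * (\<Sum>y\<in>?I. 2 * ((?p y - 1 / R)\<^sup>2 + (?q y - 1 / R)\<^sup>2))"
  proof (intro mult_mono sum_mono sum_nonneg)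
    have "(\<Sum>y\<in>?I. (g y)\<^sup>2) \<le> (\<Sum>y\<in>?I. 1)" using g by (intro sum_mono power_le_one) auto
    then show "(\<Sum>y\<in>?I. (g y)\<^sup>2) \<le> R" by (simp add: R_def)
    have "(u - w)\<^sup>2 \<le> 2 * (u\<^sup>2 + w\<^sup>2)" for u w :: real
      using zero_le_power2[of "u + w"] by (simp add: power2_sum power2_diff algebra_simps)
    from this[of "_ - 1 / R" "_ - 1 / R"]
    show "(?p y - ?q y)\<^sup>2 \<le> 2 * ((?p y - 1 / R)\<^sup>2 + (?q y - 1 / R)\<^sup>2)" for y
      by simp
  qed (auto simp: R_def)
  also have "\<dots> = 2 * R * ((collision_prob D h X - 1 / R) + (collision_prob D h Y - 1 / R))"
    unfolding R_def sum_distrib_left[symmetric] sum.distrib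
    by (simp add: sum_power2_deviation D)
  finally show ?thesis .
qed

section \<open>Averaging over random hash keys\<close>

lemma integrable_pmf_bounded:
  fixes f :: "'a \<Rightarrow> real"
  assumes "\<And>x. x \<in> set_pmf M \<Longrightarrow> \<bar>f x\<bar> \<le> c"
  shows "integrable (measure_pmf M) f"
  using assms by (intro measure_pmf.integrable_const_bound[where B = c]) (auto simp: AE_measure_pmf_iff)

text \<open>Only the averaged reciprocal range size is controlled. Hence it is the difference between
  collision probability and reciprocal range size that is bounded, which is nonnegative for every
  single key.\<close>

lemma universal_collision_prob:
  assumes D: "finite D" "set_pmf X \<subseteq> D" and p: "\<And>x. x \<in> D \<Longrightarrow> pmf X x \<le> p"
    and univ: "\<And>x x'. x \<in> D \<Longrightarrow> x' \<in> D \<Longrightarrow> x \<noteq> x' \<Longrightarrow>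
      measure_pmf.prob V {v. L v \<and> h v x = h v x'} \<le>
      measure_pmf.expectation V (\<lambda>v. if L v then 1 / real (card (h v ` D)) else 0)"
  shows "measure_pmf.expectation V
      (\<lambda>v. if L v then collision_prob D (h v) X - 1 / card (h v ` D) else 0) \<le> p"
proof -
  define u where "u = measure_pmf.expectation V (\<lambda>v. if L v then 1 / real (card (h v ` D)) else 0)"
  have R1: "\<bar>1 / real (card (h v ` D))\<bar> \<le> 1" for v by (simp add: divide_le_eq)
  have u0: "0 \<le> u" unfolding u_def by (intro integral_nonneg_AE) auto
  have p0: "0 \<le> p"
    using p D(2) set_pmf_not_empty[of X] pmf_nonneg order.trans by (metis all_not_in_conv subsetD)
  have int: "integrable (measure_pmf V) (\<lambda>v. pmf X x * pmf X x' * of_bool (L v \<and> h v x = h v x'))"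
    for x x'
    by (rule integrable_pmf_bounded[of _ _ 1]) (auto simp: pmf_le_1 mult_le_one)
  have "measure_pmf.expectation V (\<lambda>v. if L v then collision_prob D (h v) X else 0) =
      measure_pmf.expectation V
        (\<lambda>v. \<Sum>x\<in>D. \<Sum>x'\<in>D. pmf X x * pmf X x' * of_bool (L v \<and> h v x = h v x'))"
    by (intro Bochner_Integration.integral_cong) (auto simp: collision_prob_def)
  also have "\<dots> = (\<Sum>x\<in>D. \<Sum>x'\<in>D. pmf X x * pmf X x' *
      measure_pmf.expectation V (\<lambda>v. of_bool (L v \<and> h v x = h v x')))"
    using int by (simp add: Bochner_Integration.integral_sum Bochner_Integration.integrable_sum)
  also have "\<dots> = (\<Sum>x\<in>D. \<Sum>x'\<in>D. pmf X x * pmf X x' *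
      measure_pmf.prob V {v. L v \<and> h v x = h v x'})"
  proof -
    have "measure_pmf.expectation V (\<lambda>v. of_bool (Q v)) = measure_pmf.prob V {v. Q v}" for Q
    proof -
      have "measure_pmf.expectation V (\<lambda>v. of_bool (Q v)) = measure_pmf.expectation V (indicator {v. Q v})"
        by (intro Bochner_Integration.integral_cong) (auto simp: indicator_def)
      also have "\<dots> = measure_pmf.prob V {v. Q v}" by simp
      finally show ?thesis .
    qed
    then show ?thesis by simp
  qed
  \<comment> \<open>Universality handles pairs of distinct points. On the diagonal a collision is
    certain, but one factor \<open>pmf X x\<close> is at most \<open>p\<close> and the other sums to
    one. The term with \<open>u\<close> is granted to the diagonal as well, so that the double sum
    factorises.\<close>
  also have "\<dots> \<le> (\<Sum>x\<in>D. \<Sum>x'\<in>D. pmf X x * pmf X x' * u + (if x' = x then pmf X x * p else 0))"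
  proof (intro sum_mono)
    fix x x' assume x: "x \<in> D" "x' \<in> D"
    show "pmf X x * pmf X x' * measure_pmf.prob V {v. L v \<and> h v x = h v x'} \<le>
      pmf X x * pmf X x' * u + (if x' = x then pmf X x * p else 0)"
    proof (cases "x = x'")
      case True
      have "pmf X x * pmf X x * measure_pmf.prob V {v. L v \<and> h v x = h v x'} \<le> pmf X x * p * 1"
        using p[OF x(1)] p0 by (intro mult_mono) auto
      then show ?thesis using True u0 by (simp add: add_increasing)
    next
      case False
      then show ?thesis using univ[OF x False] by (auto simp: u_def intro: mult_left_mono)
    qed
  qed
  also have "\<dots> = u + p"
  proof -
    have "(\<Sum>x\<in>D. \<Sum>x'\<in>D. pmf X x * pmf X x' * u) = u"
      unfolding sum_distrib_right[symmetric] sum_product[symmetric]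
      using D by (simp add: sum_pmf_eq_1)
    moreover have "(\<Sum>x\<in>D. \<Sum>x'\<in>D. if x' = x then pmf X x * p else 0) = p"
      using D by (simp add: sum.delta' sum_distrib_right[symmetric] sum_pmf_eq_1)
    ultimately show ?thesis by (simp add: sum.distrib)
  qed
  finally have le: "measure_pmf.expectation V (\<lambda>v. if L v then collision_prob D (h v) X else 0) \<le> u + p" .
  have "0 \<le> collision_prob D k X" for k :: "'a \<Rightarrow> 'c"
    unfolding collision_prob_def by (intro sum_nonneg) auto
  then have "integrable (measure_pmf V) (\<lambda>v. if L v then collision_prob D (h v) X else 0)"
    using collision_prob_le_1[OF D] by (intro integrable_pmf_bounded[of _ _ 1]) auto
  moreover have "integrable (measure_pmf V) (\<lambda>v. if L v then 1 / real (card (h v ` D)) else 0)"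
    using R1 by (intro integrable_pmf_bounded[of _ _ 1]) auto
  ultimately have "measure_pmf.expectation V
      (\<lambda>v. (if L v then collision_prob D (h v) X else 0) - (if L v then 1 / real (card (h v ` D)) else 0)) \<le> p"
    using le by (simp add: u_def)
  then show ?thesis by (simp add: if_distrib if_distribR cong: if_cong) 
qed

text \<open>The usual square root (and Jensen's inequality) is avoided by means of
  \<open>\<bar>a\<bar> \<le> \<epsilon> / 2 + a\<^sup>2 / (2 * \<epsilon>)\<close>.\<close>

lemma leftover_hash:
  fixes g :: "'v \<Rightarrow> 'b \<Rightarrow> real" and h :: "'v \<Rightarrow> 'a \<Rightarrow> 'b"
  assumes D: "finite D" "set_pmf X \<subseteq> D" "set_pmf Y \<subseteq> D"
    and p: "\<And>x. x \<in> D \<Longrightarrow> pmf X x \<le> p" "\<And>x. x \<in> D \<Longrightarrow> pmf Y x \<le> p"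
    and univ: "\<And>x x'. x \<in> D \<Longrightarrow> x' \<in> D \<Longrightarrow> x \<noteq> x' \<Longrightarrow>
      measure_pmf.prob V {v. L v \<and> h v x = h v x'} \<le>
      measure_pmf.expectation V (\<lambda>v. if L v then 1 / real (card (h v ` D)) else 0)"
    and g: "\<And>v y. 0 \<le> g v y" "\<And>v y. g v y \<le> 1"
    and K: "\<And>v. L v \<Longrightarrow> real (card (h v ` D)) \<le> K" "0 \<le> K" "K * p \<le> \<epsilon>\<^sup>2" and \<epsilon>: "\<epsilon> > 0"
  shows "measure_pmf.expectation V (\<lambda>v. if L v then \<bar>measure_pmf.expectation X (\<lambda>x. g v (h v x)) -
      measure_pmf.expectation Y (\<lambda>x. g v (h v x))\<bar> else 0) \<le> 5 / 2 * \<epsilon>"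
proof -
  define a where "a v = measure_pmf.expectation X (\<lambda>x. g v (h v x)) -
    measure_pmf.expectation Y (\<lambda>x. g v (h v x))" for v
  define c where "c Z v = (if L v then collision_prob D (h v) Z - 1 / card (h v ` D) else 0)" for Z v
  have R1: "1 / real (card (h v ` D)) \<le> 1" for v by (simp add: divide_le_eq)
  have c0: "0 \<le> c Z v" if "set_pmf Z \<subseteq> D" for Z v
    using collision_prob_ge[OF D(1) that] by (auto simp: c_def)
  have "c Z v \<le> 1" if "set_pmf Z \<subseteq> D" for Z v
  proof -
    have "0 \<le> 1 / real (card (h v ` D))" by simp
    then show ?thesis using collision_prob_le_1[OF D(1) that, of "h v"] unfolding c_def by (smt (verit))
  qed
  then have int: "integrable (measure_pmf V) (c Z)" if "set_pmf Z \<subseteq> D" for Z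
    using c0[OF that] that by (intro integrable_pmf_bounded[of _ _ 1]) auto
  have pt: "(if L v then \<bar>a v\<bar> else 0) \<le> \<epsilon> / 2 + K / \<epsilon> * (c X v + c Y v)" for v
  proof (cases "L v")
    case True
    have "(a v)\<^sup>2 \<le> 2 * real (card (h v ` D)) * (c X v + c Y v)"
      using distinguish_le_collision_prob[OF D, of "g v" "h v"] g True by (simp add: a_def c_def)
    also have "\<dots> \<le> 2 * K * (c X v + c Y v)"
      using K(1)[OF True] c0[OF D(2)] c0[OF D(3)] by (intro mult_right_mono add_nonneg_nonneg) auto
    finally have a2: "(a v)\<^sup>2 \<le> 2 * K * (c X v + c Y v)" .
    have "2 * \<epsilon> * \<bar>a v\<bar> \<le> \<epsilon>\<^sup>2 + (a v)\<^sup>2"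
      using sum_squares_bound[of \<epsilon> "\<bar>a v\<bar>"] by simp
    then have "2 * \<epsilon> * \<bar>a v\<bar> \<le> \<epsilon>\<^sup>2 + 2 * K * (c X v + c Y v)" using a2 by linarith
    then have "\<bar>a v\<bar> \<le> (\<epsilon>\<^sup>2 + 2 * K * (c X v + c Y v)) / (2 * \<epsilon>)"
      using \<epsilon> by (simp add: field_simps)
    also have "\<dots> = \<epsilon> / 2 + K / \<epsilon> * (c X v + c Y v)"
      using \<epsilon> by (simp add: field_simps power2_eq_square)
    finally show ?thesis using True by simp
  next
    case False
    then show ?thesis using \<epsilon> K(2) c0[OF D(2)] c0[OF D(3)] by simp
  qed
  have E: "measure_pmf.expectation V (c Z) \<le> p"
    if "set_pmf Z \<subseteq> D" "\<And>x. x \<in> D \<Longrightarrow> pmf Z x \<le> p" for Z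
    using universal_collision_prob[OF D(1) that univ] by (simp add: c_def[abs_def])
  have "\<bar>a v\<bar> \<le> 1" for v
  proof -
    have "0 \<le> measure_pmf.expectation Z (\<lambda>x. g v (h v x))" for Z
      using g by (intro integral_nonneg_AE) auto
    moreover have "measure_pmf.expectation Z (\<lambda>x. g v (h v x)) \<le> 1" for Z
      using g by (intro measure_pmf.integral_le_const integrable_pmf_bounded[of _ _ 1]) auto
    ultimately show ?thesis unfolding a_def by (smt (verit))
  qed
  then have "measure_pmf.expectation V (\<lambda>v. if L v then \<bar>a v\<bar> else 0) \<le>
      measure_pmf.expectation V (\<lambda>v. \<epsilon> / 2 + K / \<epsilon> * (c X v + c Y v))"
    using int[OF D(2)] int[OF D(3)] pt
    by (intro integral_mono) (auto intro: integrable_pmf_bounded[of _ _ 1])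
  also have "\<dots> = \<epsilon> / 2 + K / \<epsilon> * (measure_pmf.expectation V (c X) + measure_pmf.expectation V (c Y))"
    using int[OF D(2)] int[OF D(3)] by simp
  also have "\<dots> \<le> \<epsilon> / 2 + K / \<epsilon> * (p + p)"
    using E[OF D(2) p(1)] E[OF D(3) p(2)] K(2) \<epsilon> by (intro add_left_mono mult_left_mono add_mono) auto
  also have "\<dots> = \<epsilon> / 2 + 2 * (K * p) / \<epsilon>" by simp
  \<comment> \<open>Here the entropy condition \<open>K * p \<le> \<epsilon>^2\<close> enters; it
    balances the second term against the first.\<close>
  also have "\<dots> \<le> \<epsilon> / 2 + 2 * \<epsilon>\<^sup>2 / \<epsilon>"
    using K(3) \<epsilon> by (intro add_left_mono divide_right_mono mult_left_mono) auto
  also have "\<dots> = 5 / 2 * \<epsilon>" using \<epsilon> by (simp add: power2_eq_square)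
  finally show ?thesis unfolding a_def .
qed

section \<open>The reduction\<close>

type_synonym outcome = "(tree \<times> tree \<times> tree \<times> tree \<times> ident list \<times> ident \<times> tree) option"

text \<open>The components of an outcome are \<open>pms\<close>, the master public key that the adversary has seen, \<open>mpk\<^sub>1\<close>, \<open>msk\<^sub>1\<close>,
  \<open>IS\<close>, \<open>id\<^sup>\<star>\<close> and the state kept for the guessing stage.\<close>

definition view :: "params \<Rightarrow> hib_tdf \<Rightarrow> sibling \<Rightarrow> (tree, 'z) adversary_scheme \<Rightarrow> world \<Rightarrow> nat \<Rightarrow>
    outcome pmf" where
  "view pp HF LHF B w \<rho> = do {
     pms \<leftarrow> gen_pms pp HF \<rho>;
     (idd, st) \<leftarrow> commit B (\<rho>, pms);
     (mpk0, msk0) \<leftarrow> MKg HF pms;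
     (mpk1, msk1) \<leftarrow> LMKg LHF pms (encode idd);
     res \<leftarrow> (case w of
         REAL \<Rightarrow> interact (queries B \<rho>) (act B) (Kg HF pms msk0) (Del HF pms mpk0)
                   Map.empty [] st (Some mpk0)
       | LOSSY \<Rightarrow> interact (queries B \<rho>) (act B) (LKg LHF pms msk1) (Del HF pms mpk1)
                   Map.empty [] st (Some mpk1));
     return_pmf (map_option (\<lambda>(ids, s, IS).
       (pms, (case w of REAL \<Rightarrow> mpk0 | LOSSY \<Rightarrow> mpk1), mpk1, msk1, IS, ids, s)) res)}"

section \<open>The experiments as functions of the view\<close>

definition output_bit :: "(nat \<Rightarrow> tree \<Rightarrow> tree \<Rightarrow> ident \<Rightarrow> tree \<Rightarrow> bool pmf) \<Rightarrow> nat \<Rightarrow> outcome \<Rightarrow>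
    bool pmf" where
  "output_bit F \<rho> v = (case v of None \<Rightarrow> return_pmf False
     | Some (pms, mpk, mpk1, msk1, IS, ids, s) \<Rightarrow> F \<rho> pms mpk ids s)"

definition no_abort_bit :: "hib_tdf \<Rightarrow> pre_output \<Rightarrow> real \<Rightarrow> rat \<Rightarrow> outcome \<Rightarrow> bool pmf" where
  "no_abort_bit HF P \<omega> \<zeta> v = (case v of None \<Rightarrow> return_pmf False
     | Some (pms, mpk, mpk1, msk1, IS, ids, s) \<Rightarrow>
         map_pmf (\<lambda>d2. d1 HF \<omega> pms mpk1 IS ids \<and> d2) (P (\<zeta>, pms, mpk1, msk1, IS, ids)))"

text \<open>\<open>F\<close> acts only after the interaction, so all adversaries obtained from
  \<open>B\<close> share the distribution \<open>view\<close> and can be compared on it.\<close>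

lemma game_wrap:
  "game pp HF LHF (wrap B F) w \<rho> = bind_pmf (view pp HF LHF B w \<rho>) (\<lambda>v. case v of
     None \<Rightarrow> return_pmf None
   | Some (pms, mpk, mpk1, msk1, IS, ids, s) \<Rightarrow>
       map_pmf (\<lambda>d. Some (pms, mpk1, msk1, IS, ids, d)) (F \<rho> pms mpk ids s))"
proof -
  let ?g = "\<lambda>v. case v of None \<Rightarrow> return_pmf None
   | Some (pms, mpk, mpk1, msk1, IS, ids, s) \<Rightarrow>
       map_pmf (\<lambda>d. Some (pms, mpk1, msk1, IS, ids, d)) (F \<rho> pms mpk ids s)"
  have "bind_pmf (interact q (act (wrap B F)) kg del Map.empty [] (encode (\<rho>, pms, Leaf, st)) (Some mpk))
      (\<lambda>res. return_pmf (map_option (\<lambda>(ids, dA, IS). (pms, mpk1, msk1, IS, ids, dA)) res)) =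
    bind_pmf (interact q (act B) kg del Map.empty [] st (Some mpk))
      (\<lambda>res. ?g (map_option (\<lambda>(ids, s, IS). (pms, mpk, mpk1, msk1, IS, ids, s)) res))"
    for q kg del pms st mpk and mpk1 msk1 :: tree
    unfolding interact_wrap bind_assoc_pmf
    by (rule bind_pmf_cong[OF refl])
      (auto simp: finish_def map_pmf_def bind_assoc_pmf bind_return_pmf split: option.split)
  then show ?thesis
    unfolding game_def view_def
    by (cases w) (simp_all only: world.case commit_wrap bind_map_pmf bind_assoc_pmf bind_return_pmf
      case_prod_beta' fst_conv snd_conv queries_wrap)
qed

text \<open>Given the outcome, the output bit and the no-abort bit are independent, and the latter
  is the same for every \<open>F\<close>. Joint probabilities thus become expectations of products
  over \<open>view\<close>.\<close>

lemma loss_exp_wrap: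
  "loss_exp pp HF LHF P \<omega> \<zeta> (wrap B F) w \<rho> = bind_pmf (view pp HF LHF B w \<rho>)
     (\<lambda>v. pair_pmf (output_bit F \<rho> v) (no_abort_bit HF P (\<omega> \<rho>) (\<zeta> \<rho>) v))"
  unfolding loss_exp_def game_wrap bind_assoc_pmf
  by (rule bind_pmf_cong[OF refl])
    (auto simp: output_bit_def no_abort_bit_def bind_assoc_pmf bind_return_pmf bind_map_pmf
      pair_pmf_def map_pmf_def split: option.split)

text \<open>In the \<open>REAL\<close> world \<open>B\<close> sees exactly the genuine keys of the
  guessing experiment; the lossy key pair that \<open>view\<close> draws in addition integrates
  out.\<close>

lemma guess_exp_view:
  "guess_exp pp (hib_de_of HF) B M \<rho> = bind_pmf (view pp HF LHF B REAL \<rho>)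
     (output_bit (\<lambda>\<rho> pms mpk ids s. bind_pmf (M \<rho>) (\<lambda>m. guess B (s, Eval HF pms mpk ids m))) \<rho>)"
  unfolding guess_exp_def view_def de_gen_pms_def gen_pms_def hib_de_of_def hib_de.simps bind_assoc_pmf
  by (simp add: bind_assoc_pmf bind_return_pmf case_prod_beta' output_bit_def o_def
      cong del: option.case_cong_weak)

lemma pmf_pair_and: "pmf (map_pmf (\<lambda>(a, b). a \<and> b) (pair_pmf p q)) True = pmf p True * pmf q True"
proof -
  have "(\<lambda>(a, b). a \<and> b) -` {True} = {(True, True)}" by auto
  then show ?thesis by (simp add: pmf_map measure_pmf_single pmf_pair)
qed

lemma prob_eq_pmf_True: "measure_pmf.prob E {x. Q x} = pmf (map_pmf Q E) True"
  by (simp add: pmf_map vimage_def)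

lemma loss_exp_wrap_probs:
  fixes pp HF LHF P \<omega> \<zeta> w \<rho> and B :: "(tree, 'z) adversary_scheme"
  defines "V \<equiv> view pp HF LHF B w \<rho>"
    and "n \<equiv> \<lambda>v. pmf (no_abort_bit HF P (\<omega> \<rho>) (\<zeta> \<rho>) v) True"
    and "E \<equiv> \<lambda>F. loss_exp pp HF LHF P \<omega> \<zeta> (wrap B F) w \<rho>"
  shows "measure_pmf.prob (E F) {(dA, na). dA \<and> na} =
      measure_pmf.expectation V (\<lambda>v. pmf (output_bit F \<rho> v) True * n v)"
    and "measure_pmf.prob (E F) {(dA, na). dA} =
      measure_pmf.expectation V (\<lambda>v. pmf (output_bit F \<rho> v) True)"
    and "measure_pmf.prob (E F) {(dA, na). na} = measure_pmf.expectation V n"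
proof -
  have E: "map_pmf f (E F) = bind_pmf V (\<lambda>v. map_pmf f
      (pair_pmf (output_bit F \<rho> v) (no_abort_bit HF P (\<omega> \<rho>) (\<zeta> \<rho>) v)))" for f :: "_ \<Rightarrow> bool"
    unfolding E_def V_def loss_exp_wrap map_bind_pmf ..
  show "measure_pmf.prob (E F) {(dA, na). dA \<and> na} =
      measure_pmf.expectation V (\<lambda>v. pmf (output_bit F \<rho> v) True * n v)"
    unfolding prob_eq_pmf_True E pmf_bind pmf_pair_and n_def ..
  have "(\<lambda>(dA :: bool, na :: bool). dA) = fst" "(\<lambda>(dA :: bool, na :: bool). na) = snd" by auto
  then show "measure_pmf.prob (E F) {(dA, na). dA} =
      measure_pmf.expectation V (\<lambda>v. pmf (output_bit F \<rho> v) True)"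
    and "measure_pmf.prob (E F) {(dA, na). na} = measure_pmf.expectation V n"
    unfolding prob_eq_pmf_True by (simp_all only: E pmf_bind map_fst_pair_pmf map_snd_pair_pmf n_def)
qed

lemma view_support:
  assumes "Some (pms, mpk, mpk1, msk1, IS, ids, s) \<in> set_pmf (view pp HF LHF B w \<rho>)"
  shows "pms \<in> set_pmf (gen_pms pp HF \<rho>)" and "w = LOSSY \<Longrightarrow> mpk = mpk1"
proof -
  have [simp]: "Some y = map_option f z \<longleftrightarrow> (\<exists>a. z = Some a \<and> f a = y)" for y :: 'b and f and z :: "'c option"
    by (cases z) auto
  show "pms \<in> set_pmf (gen_pms pp HF \<rho>)" "w = LOSSY \<Longrightarrow> mpk = mpk1"
    using assms unfolding view_def by (auto simp: set_pmf_not_empty split: world.splits if_splits)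
qed

lemma None_notin_view:
  assumes "ppt_adversary B"
  shows "None \<notin> set_pmf (view pp HF LHF B w \<rho>)"
proof -
  have q: "k \<le> queries B \<rho>" if "reach B \<rho> pms idd QS IS k len st msg" for pms idd QS IS k len st msg
    using assms that unfolding ppt_adversary_def by blast
  have "None \<notin> set_pmf (interact (queries B \<rho>) (act B) kg del keys L st (Some mpk))"
    if "(idd, st) \<in> set_pmf (commit B (\<rho>, pms))" for idd st pms kg del keys L mpk
    by (rule interact_not_None[OF q reach.start[OF that]]) simp_all
  then show ?thesis unfolding view_def by (auto split: world.splits)
qed

section \<open>Sources and ranges of lossy functions\<close>

lemma card_bitstrings: "card (bitstrings n) = 2 ^ n" "finite (bitstrings n)"
  using card_lists_length_eq[of "UNIV :: bool set" n] finite_lists_length_eq[of "UNIV :: bool set" n]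
  by (auto simp: bitstrings_def card_UNIV_bool)

lemma sourceD:
  assumes "source t s X"
  shows "set_pmf X \<subseteq> bitstrings s" and "pmf X x \<le> 2 powr (- t)"
proof -
  show sub: "set_pmf X \<subseteq> bitstrings s" using assms by (simp add: source_def)
  let ?m = "Max (pmf X ` bitstrings s)"
  have le: "pmf X y \<le> ?m" if "y \<in> bitstrings s" for y
    using that card_bitstrings(2) by (intro Max_ge) auto
  \<comment> \<open>The logarithm can be inverted only at a positive argument; a point of the
    support shows that the maximum is positive.\<close>
  obtain y where y: "y \<in> set_pmf X" using set_pmf_not_empty by fast
  then have pos: "?m > 0" using le[of y] sub pmf_positive[OF y] by fastforce
  have "log 2 ?m \<le> - t" using assms by (simp add: source_def min_entropy_def)
  then have m: "?m \<le> 2 powr (- t)" using pos by (simp add: log_le_iff)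
  show "pmf X x \<le> 2 powr (- t)"
  proof (cases "x \<in> bitstrings s")
    case True then show ?thesis using le[OF True] m by simp
  next
    case False
    then have "pmf X x = 0" using sub by (auto simp: pmf_eq_0_set_pmf)
    then show ?thesis by simp
  qed
qed

lemma card_image_le_of_lossiness:
  assumes "finite D" "D \<noteq> {}" "lossiness D f \<ge> \<omega>"
  shows "real (card (f ` D)) \<le> real (card D) * 2 powr (- \<omega>)"
proof -
  have pos: "real (card D) > 0" "real (card (f ` D)) > 0" using assms by (auto simp: card_gt_0_iff)
  then have "2 powr \<omega> \<le> real (card D) / real (card (f ` D))"
    using assms(3) by (simp add: lossiness_def le_log_iff)
  then show ?thesis using pos by (simp add: powr_minus field_simps)
qed

definition lossy_outcome :: "hib_tdf \<Rightarrow> real \<Rightarrow> outcome \<Rightarrow> bool" where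
  "lossy_outcome HF \<omega> v = (case v of None \<Rightarrow> False
     | Some (pms, mpk, mpk1, msk1, IS, ids, s) \<Rightarrow> loss HF pms mpk1 ids \<ge> \<omega>)"

definition outcome_fun :: "hib_tdf \<Rightarrow> outcome \<Rightarrow> bool list \<Rightarrow> tree" where
  "outcome_fun HF v = (case v of None \<Rightarrow> (\<lambda>_. Leaf)
     | Some (pms, mpk, mpk1, msk1, IS, ids, s) \<Rightarrow> Eval HF pms mpk1 ids)"

abbreviation accept :: "nat \<Rightarrow> tree \<Rightarrow> tree \<Rightarrow> ident \<Rightarrow> tree \<Rightarrow> bool pmf" where
  "accept \<equiv> \<lambda>\<rho> pms mpk ids s. return_pmf True"

lemma ppt_accept: "ppt (\<lambda>(\<rho>, pms, mpk, u, st). accept \<rho> pms mpk u st)"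
  using poly_time_const[of True] by (simp add: case_prod_beta')

text \<open>Universality speaks about games of adversaries that output a bit. Wrapping
  \<open>B\<close> with \<open>accept\<close> gives such a game, and its result is the image of the
  view under \<open>f\<close>, which forgets the key seen and the state of \<open>B\<close>.\<close>

lemma universal_view:
  assumes univ: "universal sec pp HF LHF \<omega>"
    and B: "ppt_adversary B" "legal sec (gen_pms pp HF) (IdSp HF) B"
    and inp: "\<forall>pms \<in> set_pmf (gen_pms pp HF \<rho>). InpSp HF pms = bitstrings (inp_len pp \<rho>)"
    and x: "x \<in> bitstrings (inp_len pp \<rho>)" "x' \<in> bitstrings (inp_len pp \<rho>)" "x \<noteq> x'"
  defines "V \<equiv> view pp HF LHF B LOSSY \<rho>"
  shows "measure_pmf.prob V {v. lossy_outcome HF (\<omega> \<rho>) v \<and> outcome_fun HF v x = outcome_fun HF v x'} \<le>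
    measure_pmf.expectation V (\<lambda>v. if lossy_outcome HF (\<omega> \<rho>) v
      then 1 / real (card (outcome_fun HF v ` bitstrings (inp_len pp \<rho>))) else 0)"
proof -
  define f where
    "f = map_option (\<lambda>(pms :: tree, mpk :: tree, mpk1 :: tree, msk1 :: tree, IS :: ident list,
       ids :: ident, s :: tree). (pms, mpk1, msk1, IS, ids, True))"
  let ?G = "game pp HF LHF (wrap B accept) LOSSY \<rho>"
  have G: "?G = map_pmf f V"
    unfolding game_wrap V_def map_pmf_def f_def
    by (rule bind_pmf_cong[OF refl]) (auto simp: bind_return_pmf split: option.split)
  \<comment> \<open>These identities are needed on the support only, where \<open>pms\<close> was
    generated and its input space is therefore known.\<close>
  have fv: "lossy_at HF (\<omega> \<rho>) (f v) \<longleftrightarrow> lossy_outcome HF (\<omega> \<rho>) v"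
    "lossy_outcome HF (\<omega> \<rho>) v \<Longrightarrow> collide HF x x' (f v) \<longleftrightarrow> outcome_fun HF v x = outcome_fun HF v x'"
    "lossy_outcome HF (\<omega> \<rho>) v \<Longrightarrow>
      range_size HF (f v) = card (outcome_fun HF v ` bitstrings (inp_len pp \<rho>))"
    if "v \<in> set_pmf V" for v
  proof -
    consider "v = None" | pms mpk mpk1 msk1 IS ids s where "v = Some (pms, mpk, mpk1, msk1, IS, ids, s)"
      "InpSp HF pms = bitstrings (inp_len pp \<rho>)"
    proof (cases v)
      case (Some a)
      obtain pms mpk mpk1 msk1 IS ids s where "a = (pms, mpk, mpk1, msk1, IS, ids, s)" by (cases a)
      then show ?thesis
        using Some that(2) inp view_support(1)[of pms mpk mpk1 msk1 IS ids s pp HF LHF B LOSSY \<rho>]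
          \<open>v \<in> set_pmf V\<close> unfolding V_def by simp
    qed (rule that(1))
    note v_cases = this
    show "lossy_at HF (\<omega> \<rho>) (f v) \<longleftrightarrow> lossy_outcome HF (\<omega> \<rho>) v"
      by (cases rule: v_cases) (simp_all add: lossy_at_def lossy_outcome_def f_def)
    show "collide HF x x' (f v) \<longleftrightarrow> outcome_fun HF v x = outcome_fun HF v x'"
      if "lossy_outcome HF (\<omega> \<rho>) v"
      using that x(1,2)
      by (cases rule: v_cases) (auto simp: lossy_outcome_def collide_def outcome_fun_def f_def)
    show "range_size HF (f v) = card (outcome_fun HF v ` bitstrings (inp_len pp \<rho>))"
      if "lossy_outcome HF (\<omega> \<rho>) v"
      using that
      by (cases rule: v_cases) (auto simp: lossy_outcome_def range_size_def outcome_fun_def f_def)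
  qed
  have "measure_pmf.prob V {v. lossy_outcome HF (\<omega> \<rho>) v \<and> outcome_fun HF v x = outcome_fun HF v x'} =
      measure_pmf.prob V (f -` {res. lossy_at HF (\<omega> \<rho>) res \<and> collide HF x x' res})"
    by (intro measure_pmf.finite_measure_eq_AE) (auto simp: AE_measure_pmf_iff fv)
  also have "\<dots> = measure_pmf.prob ?G {res. lossy_at HF (\<omega> \<rho>) res \<and> collide HF x x' res}"
    unfolding G by simp
  also have "\<dots> \<le> measure_pmf.expectation ?G
      (\<lambda>res. if lossy_at HF (\<omega> \<rho>) res then 1 / real (range_size HF res) else 0)"
    using univ ppt_adversary_wrap[OF B(1) ppt_accept] legal_wrap[OF B(2)] x(3)
    unfolding universal_def by blast
  also have "\<dots> = measure_pmf.expectation V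
      (\<lambda>v. if lossy_at HF (\<omega> \<rho>) (f v) then 1 / real (range_size HF (f v)) else 0)"
    unfolding G by simp
  also have "\<dots> = measure_pmf.expectation V (\<lambda>v. if lossy_outcome HF (\<omega> \<rho>) v
      then 1 / real (card (outcome_fun HF v ` bitstrings (inp_len pp \<rho>))) else 0)"
    by (intro integral_cong_AE) (auto simp: AE_measure_pmf_iff fv)
  finally show ?thesis .
qed

section \<open>The coin-flipping distinguisher in both worlds\<close>

definition guess_stage :: "hib_tdf \<Rightarrow> priv_adversary \<Rightarrow> (nat \<Rightarrow> bool list pmf) \<Rightarrow>
    nat \<Rightarrow> tree \<Rightarrow> tree \<Rightarrow> ident \<Rightarrow> tree \<Rightarrow> bool pmf" where
  "guess_stage HF B M \<rho> pms mpk ids s = bind_pmf (M \<rho>) (\<lambda>m. guess B (s, Eval HF pms mpk ids m))"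

definition distinguish :: "hib_tdf \<Rightarrow> priv_adversary \<Rightarrow> (nat \<Rightarrow> bool list pmf) \<Rightarrow>
    (nat \<Rightarrow> bool list pmf) \<Rightarrow> nat \<Rightarrow> tree \<Rightarrow> tree \<Rightarrow> ident \<Rightarrow> tree \<Rightarrow> bool pmf" where
  "distinguish HF B M0 M1 \<rho> pms mpk ids s = bind_pmf (bernoulli_pmf (1/2)) (\<lambda>b.
     if b then guess_stage HF B M0 \<rho> pms mpk ids s
     else map_pmf Not (guess_stage HF B M1 \<rho> pms mpk ids s))"

lemma poly_time_Not: "poly_time Not"
proof -
  have "(\<lambda>b. if b then return_pmf False else return_pmf True) = (\<lambda>b. return_pmf (\<not> b))" by auto
  with ppt_if[OF poly_time_id poly_time_const[of False] poly_time_const[of True]]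
  show ?thesis by (simp only:)
qed

lemma ppt_guess_stage:
  assumes "ppt M" "ppt (guess B)" "poly_time (\<lambda>(pms, mpk, u, x). Eval HF pms mpk u x)"
  shows "ppt (\<lambda>(\<rho>, pms, mpk, u, s). guess_stage HF B M \<rho> pms mpk u s)"
proof -
  have "poly_time (\<lambda>p :: (nat \<times> tree \<times> tree \<times> ident \<times> tree) \<times> bool list.
      (fst (snd (fst p)), fst (snd (snd (fst p))), fst (snd (snd (snd (fst p)))), snd p))"
    by (intro poly_time_intros)
  from ppt_comp[OF assms(3) this]
  have E: "poly_time (\<lambda>p :: (nat \<times> tree \<times> tree \<times> ident \<times> tree) \<times> bool list.
      Eval HF (fst (snd (fst p))) (fst (snd (snd (fst p)))) (fst (snd (snd (snd (fst p))))) (snd p))"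
    unfolding prod.case .
  show ?thesis
    unfolding guess_stage_def case_prod_beta'
    by (intro ppt_bind ppt_comp[OF assms(1)] ppt_comp[OF assms(2)] poly_time_Pair E poly_time_intros)
qed

lemma ppt_distinguish:
  assumes "ppt M0" "ppt M1" "ppt (guess B)" "poly_time (\<lambda>(pms, mpk, u, x). Eval HF pms mpk u x)"
  shows "ppt (\<lambda>(\<rho>, pms, mpk, u, s). distinguish HF B M0 M1 \<rho> pms mpk u s)"
proof -
  have G: "ppt (\<lambda>p :: (nat \<times> tree \<times> tree \<times> ident \<times> tree) \<times> bool. case fst p of (\<rho>, pms, mpk, u, s) \<Rightarrow>
      guess_stage HF B M \<rho> pms mpk u s)" if "ppt M" for M
    by (rule ppt_comp[OF ppt_guess_stage[OF that assms(3,4)]]) (intro poly_time_intros)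
  have "ppt (\<lambda>p :: (nat \<times> tree \<times> tree \<times> ident \<times> tree) \<times> bool. if snd p
      then (case fst p of (\<rho>, pms, mpk, u, s) \<Rightarrow> guess_stage HF B M0 \<rho> pms mpk u s)
      else map_pmf Not (case fst p of (\<rho>, pms, mpk, u, s) \<Rightarrow> guess_stage HF B M1 \<rho> pms mpk u s))"
    by (intro ppt_if ppt_map_pmf G assms poly_time_Not poly_time_intros)
  from ppt_bind[OF ppt_bernoulli this] show ?thesis
    unfolding distinguish_def case_prod_beta' .
qed

lemma pmf_distinguish:
  "pmf (distinguish HF B M0 M1 \<rho> pms mpk ids s) True =
    1 / 2 + (pmf (guess_stage HF B M0 \<rho> pms mpk ids s) True -
      pmf (guess_stage HF B M1 \<rho> pms mpk ids s) True) / 2"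
proof -
  have "Not -` {True} = {False}" by auto
  then have "pmf (map_pmf Not q) True = 1 - pmf q True" for q
    by (simp add: pmf_map measure_pmf_single pmf_False_conv_True)
  note this[simp]
  show ?thesis by (simp add: distinguish_def pmf_bind) (simp add: field_simps)
qed

lemma pmf_guess_exp:
  "pmf (guess_exp pp (hib_de_of HF) B M \<rho>) True =
    measure_pmf.expectation (view pp HF LHF B REAL \<rho>)
      (\<lambda>v. pmf (output_bit (guess_stage HF B M) \<rho> v) True)"
proof -
  have "guess_stage HF B M =
      (\<lambda>\<rho> pms mpk ids s. bind_pmf (M \<rho>) (\<lambda>m. guess B (s, Eval HF pms mpk ids m)))"
    by (intro ext) (simp add: guess_stage_def)
  then show ?thesis
    unfolding guess_exp_view[of pp HF B M \<rho> LHF] pmf_bind by simp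
qed

lemma abs_pmf_le_1: "\<bar>pmf p x\<bar> \<le> 1"
  by (simp add: pmf_le_1)

lemma pmf_output_distinguish:
  assumes "v \<noteq> None"
  shows "pmf (output_bit (distinguish HF B M0 M1) \<rho> v) True =
    1 / 2 + (pmf (output_bit (guess_stage HF B M0) \<rho> v) True -
      pmf (output_bit (guess_stage HF B M1) \<rho> v) True) / 2"
  using assms by (auto simp: output_bit_def pmf_distinguish)

lemma real_distinguish:
  assumes "ppt_adversary B"
  shows "measure_pmf.prob (loss_exp pp HF LHF P \<omega> \<zeta> (wrap B (distinguish HF B M0 M1)) REAL \<rho>)
      {(dA, na). dA} = 1 / 2 + adv_priv1 pp (hib_de_of HF) B M0 M1 \<rho> / 2"
proof -
  let ?V = "view pp HF LHF B REAL \<rho>"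
  let ?G = "\<lambda>M v. pmf (output_bit (guess_stage HF B M) \<rho> v) True"
  have int: "integrable (measure_pmf ?V) (?G M)" for M
    by (rule integrable_pmf_bounded[of _ _ 1]) (rule abs_pmf_le_1)
  have "measure_pmf.expectation ?V (\<lambda>v. pmf (output_bit (distinguish HF B M0 M1) \<rho> v) True) =
      measure_pmf.expectation ?V (\<lambda>v. 1 / 2 + (?G M0 v - ?G M1 v) / 2)"
  proof (intro integral_cong_AE)
    \<comment> \<open>On \<open>None\<close> the output bit is \<open>False\<close> for every
      \<open>F\<close>, so the identity with \<open>1 / 2\<close> would fail there; the query bound
      excludes this outcome.\<close>
    have "v \<noteq> None" if "v \<in> set_pmf ?V" for v
      using None_notin_view[OF assms, of pp HF LHF REAL \<rho>] that by metis
    then show "AE v in ?V. pmf (output_bit (distinguish HF B M0 M1) \<rho> v) True =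
        1 / 2 + (?G M0 v - ?G M1 v) / 2"
      by (simp add: AE_measure_pmf_iff pmf_output_distinguish)
  qed simp_all
  also have "\<dots> = 1 / 2 + adv_priv1 pp (hib_de_of HF) B M0 M1 \<rho> / 2"
    using int by (simp add: adv_priv1_def pmf_guess_exp[of pp HF B _ \<rho> LHF])
  finally show ?thesis unfolding loss_exp_wrap_probs .
qed

text \<open>With a constant bit 1 the joint event is the no-abort event, whose probability is common
  to all \<open>F\<close>. On \<open>None\<close> the bit is 0, but then so is the no-abort
  bit.\<close>

lemma accept_probs:
  shows "measure_pmf.prob (loss_exp pp HF LHF P \<omega> \<zeta> (wrap B accept) w \<rho>) {(dA, na). dA \<and> na} =
    measure_pmf.prob (loss_exp pp HF LHF P \<omega> \<zeta> (wrap B F) w \<rho>) {(dA, na). na}"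
  unfolding loss_exp_wrap_probs
  by (rule Bochner_Integration.integral_cong)
    (auto simp: output_bit_def no_abort_bit_def split: option.split)

lemma accept_real:
  assumes "ppt_adversary B"
  shows "measure_pmf.prob (loss_exp pp HF LHF P \<omega> \<zeta> (wrap B accept) w \<rho>) {(dA, na). dA} = 1"
proof -
  have "pmf (output_bit accept \<rho> v) True = 1" if "v \<in> set_pmf (view pp HF LHF B w \<rho>)" for v
  proof (cases v)
    case None
    then show ?thesis using None_notin_view[OF assms, of pp HF LHF w \<rho>] that by simp
  qed (auto simp: output_bit_def)
  then have "measure_pmf.expectation (view pp HF LHF B w \<rho>) (\<lambda>v. pmf (output_bit accept \<rho> v) True) =
      measure_pmf.expectation (view pp HF LHF B w \<rho>) (\<lambda>v. 1)"
    by (intro integral_cong_AE) (auto simp: AE_measure_pmf_iff)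
  then show ?thesis unfolding loss_exp_wrap_probs by simp
qed

text \<open>The bit is 1 with probability \<open>1 / 2\<close> plus half the difference between the
  two guessing probabilities. No abort forces lossiness at the challenge identity, where the
  leftover hash lemma bounds the averaged difference by \<open>5 / 2 * \<epsilon>\<close>; half of
  this remains.\<close>

lemma lossy_distinguish:
  assumes univ: "universal sec pp HF LHF \<omega>"
    and B: "ppt_adversary B" "legal sec (gen_pms pp HF) (IdSp HF) B"
    and inp: "\<forall>pms \<in> set_pmf (gen_pms pp HF \<rho>). InpSp HF pms = bitstrings (inp_len pp \<rho>)"
    and M: "source t (inp_len pp \<rho>) (M0 \<rho>)" "source t (inp_len pp \<rho>) (M1 \<rho>)"
    and \<epsilon>: "\<epsilon> > 0" and t: "t \<ge> real (inp_len pp \<rho>) - \<omega> \<rho> + 2 * log 2 (1 / \<epsilon>)"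
  shows "measure_pmf.prob (loss_exp pp HF LHF P \<omega> \<zeta> (wrap B (distinguish HF B M0 M1)) LOSSY \<rho>)
      {(dA, na). dA \<and> na} \<le>
    measure_pmf.prob (loss_exp pp HF LHF P \<omega> \<zeta> (wrap B accept) LOSSY \<rho>) {(dA, na). dA \<and> na} / 2
      + 5 / 4 * \<epsilon>"
proof -
  define V where "V = view pp HF LHF B LOSSY \<rho>"
  define D where "D = bitstrings (inp_len pp \<rho>)"
  define L where "L = lossy_outcome HF (\<omega> \<rho>)"
  define h where "h = outcome_fun HF"
  define g where "g v y = (case v of None \<Rightarrow> 0
    | Some (pms, mpk, mpk1, msk1, IS, ids, s) \<Rightarrow> pmf (guess B (s, y)) True)" for v :: outcome and y
  define n where "n v = pmf (no_abort_bit HF P (\<omega> \<rho>) (\<zeta> \<rho>) v) True" for v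
  define G where "G M v = pmf (output_bit (guess_stage HF B M) \<rho> v) True" for M v
  define K where "K = 2 powr (real (inp_len pp \<rho>) - \<omega> \<rho>)"
  have D: "finite D" "D \<noteq> {}" "real (card D) = 2 powr real (inp_len pp \<rho>)"
    using card_bitstrings[of "inp_len pp \<rho>"]
    by (auto simp: D_def powr_realpow bitstrings_def intro: exI[of _ "replicate _ True"])
  have V: "InpSp HF pms = D" "mpk = mpk1"
    if "Some (pms, mpk, mpk1, msk1, IS, ids, s) \<in> set_pmf V" for pms mpk mpk1 msk1 IS ids s
    using view_support[OF that[unfolded V_def]] inp by (auto simp: D_def)
  have g: "0 \<le> g v y" "g v y \<le> 1" for v y
    by (auto simp: g_def pmf_le_1 split: option.split)
  \<comment> \<open>In the \<open>LOSSY\<close> world the key seen by \<open>B\<close> is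
    \<open>mpk1\<close>, so the challenge ciphertext is the hash value of the message.\<close>
  have G: "G M v = measure_pmf.expectation (M \<rho>) (\<lambda>m. g v (h v m))" if "v \<in> set_pmf V" for M v
    using that
    by (cases v) (auto simp: G_def output_bit_def guess_stage_def pmf_bind g_def h_def outcome_fun_def dest: V(2))
  have KR: "real (card (h v ` D)) \<le> K" if "v \<in> set_pmf V" "L v" for v
  proof -
    obtain pms mpk mpk1 msk1 IS ids s where v: "v = Some (pms, mpk, mpk1, msk1, IS, ids, s)"
      using \<open>L v\<close> by (cases v) (auto simp: L_def lossy_outcome_def)
    then have "lossiness D (Eval HF pms mpk1 ids) \<ge> \<omega> \<rho>"
      using that V(1) by (auto simp: L_def lossy_outcome_def)
    from card_image_le_of_lossiness[OF D(1,2) this] show ?thesis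
      by (simp add: v h_def outcome_fun_def D(3) K_def powr_diff powr_minus field_simps)
  qed
  have Kp: "K * 2 powr (- t) \<le> \<epsilon>\<^sup>2"
  proof -
    have "K * 2 powr (- t) = 2 powr (real (inp_len pp \<rho>) - \<omega> \<rho> - t)"
      by (simp add: K_def powr_add[symmetric])
    \<comment> \<open>This is the entropy hypothesis, rewritten as an upper bound
      \<open>2 * log 2 \<epsilon>\<close> on the exponent.\<close>
    also have "\<dots> \<le> 2 powr (2 * log 2 \<epsilon>)"
      using t \<epsilon> by (intro powr_mono) (auto simp: log_divide)
    also have "\<dots> = \<epsilon>\<^sup>2" using \<epsilon> by (simp add: log_powr[symmetric] powr_numeral flip: powr_powr)
    finally show ?thesis .
  qed
  \<comment> \<open>Lossiness is restricted to the support because the range bound \<open>KR\<close>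
    holds only there; probabilities and expectations do not change.\<close>
  let ?L = "\<lambda>v. v \<in> set_pmf V \<and> L v"
  let ?\<Delta> = "\<lambda>v. if ?L v then \<bar>measure_pmf.expectation (M0 \<rho>) (\<lambda>x. g v (h v x)) -
      measure_pmf.expectation (M1 \<rho>) (\<lambda>x. g v (h v x))\<bar> else 0"
  have LHL: "measure_pmf.expectation V ?\<Delta> \<le> 5 / 2 * \<epsilon>"
  proof (rule leftover_hash[where K = K and p = "2 powr (- t)" and D = D and g = g and h = h and L = ?L])
    show "set_pmf (M0 \<rho>) \<subseteq> D" "set_pmf (M1 \<rho>) \<subseteq> D" using M sourceD(1) by (auto simp: D_def)
    fix x x' assume x: "x \<in> D" "x' \<in> D" "x \<noteq> x'"
    have "measure_pmf.prob V {v. ?L v \<and> h v x = h v x'} = measure_pmf.prob V {v. L v \<and> h v x = h v x'}"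
      by (intro measure_pmf.finite_measure_eq_AE) (auto simp: AE_measure_pmf_iff)
    also have "\<dots> \<le> measure_pmf.expectation V (\<lambda>v. if L v then 1 / real (card (h v ` D)) else 0)"
      using universal_view[OF univ B inp, of x x'] x unfolding D_def V_def L_def h_def by blast
    also have "\<dots> = measure_pmf.expectation V (\<lambda>v. if ?L v then 1 / real (card (h v ` D)) else 0)"
      by (intro integral_cong_AE) (auto simp: AE_measure_pmf_iff)
    finally show "measure_pmf.prob V {v. ?L v \<and> h v x = h v x'} \<le>
        measure_pmf.expectation V (\<lambda>v. if ?L v then 1 / real (card (h v ` D)) else 0)" .
  qed (use D(1) M sourceD(2) g KR Kp \<epsilon> in \<open>auto simp: K_def\<close>)
  have n01: "0 \<le> n v" "n v \<le> 1" for v by (auto simp: n_def pmf_le_1)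
  have nL: "n v = 0" if "\<not> L v" for v
    using that by (auto simp: n_def no_abort_bit_def L_def lossy_outcome_def d1_def pmf_map
        split: option.splits)
  have pt: "pmf (output_bit (distinguish HF B M0 M1) \<rho> v) True * n v \<le> n v / 2 + ?\<Delta> v / 2"
    if v: "v \<in> set_pmf V" for v
  proof (cases "L v")
    case True
    then have "v \<noteq> None" by (auto simp: L_def lossy_outcome_def split: option.splits)
    have "pmf (output_bit (distinguish HF B M0 M1) \<rho> v) True * n v = n v / 2 + (G M0 v - G M1 v) * n v / 2"
      unfolding pmf_output_distinguish[OF \<open>v \<noteq> None\<close>] G_def by (simp add: algebra_simps)
    also have "(G M0 v - G M1 v) * n v \<le> \<bar>G M0 v - G M1 v\<bar> * 1"
      using n01 by (intro mult_mono) auto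
    finally show ?thesis using True v by (simp add: G)
  qed (simp add: nL)
  have int: "integrable (measure_pmf V) n"
    using n01 by (intro integrable_pmf_bounded[of _ _ 1]) auto
  have "\<bar>?\<Delta> v\<bar> \<le> 1" if "v \<in> set_pmf V" for v
  proof -
    have "\<bar>pmf q True - pmf q' True\<bar> \<le> 1" for q q'
      using pmf_nonneg[of q True] pmf_nonneg[of q' True] pmf_le_1[of q True] pmf_le_1[of q' True]
      by linarith
    then show ?thesis unfolding G[OF that, symmetric] G_def by simp
  qed
  then have int': "integrable (measure_pmf V) ?\<Delta>"
    by (intro integrable_pmf_bounded[of _ _ 1])
  have "measure_pmf.expectation V (\<lambda>v. pmf (output_bit (distinguish HF B M0 M1) \<rho> v) True * n v) \<le>
      measure_pmf.expectation V (\<lambda>v. n v / 2 + ?\<Delta> v / 2)"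
  proof (rule integral_mono_AE)
    show "integrable V (\<lambda>v. pmf (output_bit (distinguish HF B M0 M1) \<rho> v) True * n v)"
      using n01 by (intro integrable_pmf_bounded[of _ _ 1]) (auto simp: pmf_le_1 mult_le_one)
    show "integrable V (\<lambda>v. n v / 2 + ?\<Delta> v / 2)" using int int' by simp
    show "AE v in V. pmf (output_bit (distinguish HF B M0 M1) \<rho> v) True * n v \<le> n v / 2 + ?\<Delta> v / 2"
      unfolding AE_measure_pmf_iff using pt by blast
  qed
  also have "\<dots> = measure_pmf.expectation V n / 2 + measure_pmf.expectation V ?\<Delta> / 2"
    using int int' by simp
  also have "\<dots> \<le> measure_pmf.expectation V n / 2 + 5 / 4 * \<epsilon>" using LHL by simp
  finally have le: "measure_pmf.expectation V
      (\<lambda>v. pmf (output_bit (distinguish HF B M0 M1) \<rho> v) True * n v) \<le>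
      measure_pmf.expectation V n / 2 + 5 / 4 * \<epsilon>" .
  have n: "n = (\<lambda>v. pmf (no_abort_bit HF P (\<omega> \<rho>) (\<zeta> \<rho>) v) True)" by (simp add: n_def fun_eq_iff)
  show ?thesis
    using le unfolding accept_probs[where F = accept] loss_exp_wrap_probs V_def n by simp
qed

section \<open>Asymptotic comparison of the two worlds\<close>

lemma partially_lossyE:
  assumes "partially_lossy sec pp HF LHF P \<omega> \<delta>"
    and "ppt_adversary A" "legal sec (gen_pms pp HF) (IdSp HF) A"
    and "\<And>\<rho>. 0 < \<zeta> \<rho>" "\<And>\<rho>. \<zeta> \<rho> < 1" "non_negligible_fun (\<lambda>\<rho>. real_of_rat (\<zeta> \<rho>))"
  obtains \<epsilon>1 \<epsilon>2 where "non_negligible_fun \<epsilon>1" "non_negligible_fun \<epsilon>2"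
    "\<And>\<rho>. \<delta> (queries A \<rho>) \<rho> = \<epsilon>1 \<rho> * \<epsilon>2 \<rho>"
    "negligible_fun (adv_lossy pp HF LHF P \<omega> \<zeta> A)"
    "\<And>\<rho>. measure_pmf.prob (loss_exp pp HF LHF P \<omega> \<zeta> A REAL \<rho>) {(dA, na). na} \<ge> \<epsilon>1 \<rho>"
    "\<And>\<rho>. measure_pmf.prob (loss_exp pp HF LHF P \<omega> \<zeta> A REAL \<rho>) {(dA, na). dA} - 1/2
        > real_of_rat (\<zeta> \<rho>) \<Longrightarrow>
      cond_prob (measure_pmf (loss_exp pp HF LHF P \<omega> \<zeta> A REAL \<rho>)) fst snd - 1/2
        > \<epsilon>2 \<rho> * real_of_rat (\<zeta> \<rho>)"
  using assms unfolding partially_lossy_def Let_def by meson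

lemma cond_prob_fst_snd:
  "cond_prob (measure_pmf E) fst snd =
    measure_pmf.prob E {(dA, na). dA \<and> na} / measure_pmf.prob E {(dA, na). na}"
  by (simp add: cond_prob_def case_prod_beta')

lemma non_negligible_funE:
  assumes "non_negligible_fun f"
  obtains c where "\<forall>\<^sub>F \<rho> in sequentially. 1 / real \<rho> ^ c \<le> f \<rho>"
  using assms unfolding non_negligible_fun_def by blast

lemma negligible_funD: "negligible_fun f \<Longrightarrow> \<forall>\<^sub>F \<rho> in sequentially. \<bar>f \<rho>\<bar> < 1 / real \<rho> ^ c"
  unfolding negligible_fun_def by blast

lemma non_negligible_const: "0 < c \<Longrightarrow> non_negligible_fun (\<lambda>_. c)"
  unfolding non_negligible_fun_def
proof (intro exI)
  assume "0 < c"
  have "(\<lambda>\<rho>. 1 / real \<rho> ^ 1) \<longlonglongrightarrow> 0" using lim_1_over_n[where 'a = real] by simp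
  then have "\<forall>\<^sub>F \<rho> in sequentially. 1 / real \<rho> ^ 1 < c" using \<open>0 < c\<close> order_tendstoD(2) by fast
  then show "\<forall>\<^sub>F \<rho> in sequentially. 1 / real \<rho> ^ 1 \<le> c" by eventually_elim simp
qed

text \<open>From 2 on, both 3 and \<open>\<rho> + 1\<close> are at most the square of \<rho>, which
  yields the exponent \<open>2 * c + 2\<close>.\<close>

lemma non_negligible_inverse_poly: "non_negligible_fun (\<lambda>\<rho>. 1 / (3 * (real \<rho> + 1) ^ c))"
  unfolding non_negligible_fun_def
proof (intro exI)
  show "\<forall>\<^sub>F \<rho> in sequentially. 1 / real \<rho> ^ (2 * c + 2) \<le> 1 / (3 * (real \<rho> + 1) ^ c)"
    using eventually_ge_at_top[of 2]
  proof eventually_elim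
    case (elim \<rho>)
    have "2 * real \<rho> \<le> real \<rho> * real \<rho>" using elim by (intro mult_right_mono) auto
    then have "real \<rho> + 1 \<le> (real \<rho>)\<^sup>2" "3 \<le> (real \<rho>)\<^sup>2"
      using elim unfolding power2_eq_square by linarith+
    then have "3 * (real \<rho> + 1) ^ c \<le> (real \<rho>)\<^sup>2 * ((real \<rho>)\<^sup>2) ^ c"
      by (intro mult_mono power_mono) auto
    also have "\<dots> = real \<rho> ^ (2 * c + 2)" by (simp add: power_add power_mult power2_eq_square)
    finally show ?case using elim by (intro divide_left_mono) auto
  qed
qed

text \<open>As \<zeta> is fixed beforehand from \<open>c\<close> alone, all asymptotic bounds hold
  from a common point on. Beyond it, a single \<rho> with advantage at least
  \<open>1 / \<rho> ^ c\<close> already gives a contradiction: the gap that survives conditioning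
  exceeds the sum of the negligible errors at this \<rho>.\<close>

lemma adv_priv1_eventually_less:
  fixes c :: nat
  assumes HF: "poly_time (\<lambda>(pms, mpk, u, x). Eval HF pms mpk u x)"
    and inp: "\<forall>\<rho>. \<forall>pms \<in> set_pmf (gen_pms pp HF \<rho>). InpSp HF pms = bitstrings (inp_len pp \<rho>)"
    and pl: "partially_lossy sec pp HF LHF P \<omega> \<delta>"
    and univ: "universal sec pp HF LHF \<omega>"
    and \<epsilon>: "negligible_fun \<epsilon>" "\<forall>\<rho>. \<epsilon> \<rho> > 0"
    and t: "\<forall>\<rho>. t \<rho> \<ge> real (inp_len pp \<rho>) - \<omega> \<rho> + 2 * log 2 (1 / \<epsilon> \<rho>)"
    and M: "M0 \<in> sampleable_sources t (inp_len pp)" "M1 \<in> sampleable_sources t (inp_len pp)"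
    and B: "ppt_adversary B" "ppt (guess B)" "legal sec (gen_pms pp HF) (IdSp HF) B"
  shows "\<forall>\<^sub>F \<rho> in sequentially. adv_priv1 pp (hib_de_of HF) B M0 M1 \<rho> < 1 / real \<rho> ^ c"
proof -
  \<comment> \<open>The summand 1 keeps the value between 0 and 1 at \<open>\<rho> = 0\<close>. The
    factor 3 makes \<zeta> strictly smaller than half of \<open>1 / \<rho> ^ c\<close>, since the
    distinguisher retains only half of the advantage.\<close>
  define \<zeta> :: "nat \<Rightarrow> rat" where "\<zeta> \<rho> = 1 / (3 * (of_nat \<rho> + 1) ^ c)" for \<rho>
  have \<zeta>_real: "real_of_rat (\<zeta> \<rho>) = 1 / (3 * (real \<rho> + 1) ^ c)" for \<rho>
    by (simp add: \<zeta>_def of_rat_divide of_rat_mult of_rat_power of_rat_add)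
  have "1 < 3 * (of_nat \<rho> + 1 :: rat) ^ c" for \<rho>
    by (rule less_le_trans[of 1 "3 * 1"]) (auto intro!: mult_left_mono one_le_power)
  then have \<zeta>: "0 < \<zeta> \<rho>" "\<zeta> \<rho> < 1" for \<rho> by (auto simp: \<zeta>_def)
  have nn: "non_negligible_fun (\<lambda>\<rho>. real_of_rat (\<zeta> \<rho>))"
    unfolding \<zeta>_real by (rule non_negligible_inverse_poly)
  let ?A = "wrap B (distinguish HF B M0 M1)" let ?A' = "wrap B accept"
  have "ppt M0" "ppt M1" using M by (auto simp: sampleable_sources_def)
  then have A: "ppt_adversary ?A"
    by (intro ppt_adversary_wrap B(1) ppt_distinguish B(2) HF)
  have A': "ppt_adversary ?A'" by (rule ppt_adversary_wrap[OF B(1) ppt_accept])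
  let ?E = "loss_exp pp HF LHF P \<omega> \<zeta>"
  obtain \<epsilon>1 \<epsilon>2 where e: "non_negligible_fun \<epsilon>1" "non_negligible_fun \<epsilon>2"
    and advA: "negligible_fun (adv_lossy pp HF LHF P \<omega> \<zeta> ?A)"
    and na: "\<And>\<rho>. measure_pmf.prob (?E ?A REAL \<rho>) {(dA, na). na} \<ge> \<epsilon>1 \<rho>"
    and cond: "\<And>\<rho>. measure_pmf.prob (?E ?A REAL \<rho>) {(dA, na). dA} - 1/2 > real_of_rat (\<zeta> \<rho>) \<Longrightarrow>
      cond_prob (measure_pmf (?E ?A REAL \<rho>)) fst snd - 1/2 > \<epsilon>2 \<rho> * real_of_rat (\<zeta> \<rho>)"
    by (rule partially_lossyE[OF pl A legal_wrap[OF B(3)] \<zeta> nn]) blast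
  have advA': "negligible_fun (adv_lossy pp HF LHF P \<omega> \<zeta> ?A')"
    by (rule partially_lossyE[OF pl A' legal_wrap[OF B(3)] \<zeta> nn]) blast
  obtain a where a: "\<forall>\<^sub>F \<rho> in sequentially. 1 / real \<rho> ^ a \<le> \<epsilon>1 \<rho>" by (rule non_negligible_funE[OF e(1)])
  obtain b where b: "\<forall>\<^sub>F \<rho> in sequentially. 1 / real \<rho> ^ b \<le> \<epsilon>2 \<rho>" by (rule non_negligible_funE[OF e(2)])
  obtain z where z: "\<forall>\<^sub>F \<rho> in sequentially. 1 / real \<rho> ^ z \<le> real_of_rat (\<zeta> \<rho>)"
    by (rule non_negligible_funE[OF nn])
  \<comment> \<open>The exponents \<open>a\<close>, \<open>b\<close>, \<open>z\<close> match the
    lower bounds on the gap; the two further powers absorb the constant \<open>11 / 4\<close>, as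
    \<open>\<rho> \<ge> 2\<close>.\<close>
  let ?k = "a + b + z + 2"
  show ?thesis
    using a b z negligible_funD[OF advA, of ?k] negligible_funD[OF advA', of ?k]
      negligible_funD[OF \<epsilon>(1), of ?k] eventually_ge_at_top[of 2]
  proof eventually_elim
    case (elim \<rho>)
    let ?adv = "adv_priv1 pp (hib_de_of HF) B M0 M1 \<rho>"
    let ?p = "\<lambda>A w. measure_pmf.prob (?E A w \<rho>) {(dA, na). dA \<and> na}"
    let ?r = "real \<rho>"
    show "?adv < 1 / ?r ^ c"
    proof (rule ccontr)
      assume "\<not> ?adv < 1 / ?r ^ c"
      have r: "?r \<ge> 2" using elim by simp
      have "2 * real_of_rat (\<zeta> \<rho>) < 1 / ?r ^ c"
      proof -
        have "2 * ?r ^ c < 3 * ?r ^ c" using r by simp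
        also have "\<dots> \<le> 3 * (?r + 1) ^ c" by (simp add: power_mono)
        finally show ?thesis unfolding \<zeta>_real using r by (simp add: field_simps)
      qed
      then have "measure_pmf.prob (?E ?A REAL \<rho>) {(dA, na). dA} - 1/2 > real_of_rat (\<zeta> \<rho>)"
        using \<open>\<not> ?adv < _\<close> unfolding real_distinguish[OF B(1)] by simp
      from cond[OF this]
      \<comment> \<open>The denominator of the conditional probability is written as the joint
        probability of the accepting adversary, for which partial lossiness relates the two
        worlds.\<close>
      have c: "?p ?A REAL / ?p ?A' REAL > 1/2 + \<epsilon>2 \<rho> * real_of_rat (\<zeta> \<rho>)"
        unfolding cond_prob_fst_snd accept_probs[where F = "distinguish HF B M0 M1"] by simp
      have pos: "\<epsilon>1 \<rho> > 0" "\<epsilon>2 \<rho> > 0" "real_of_rat (\<zeta> \<rho>) > 0"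
        using elim r \<zeta> by (auto intro: less_le_trans[of 0 "1 / ?r ^ _"])
      have na': "\<epsilon>1 \<rho> \<le> ?p ?A' REAL"
        using na unfolding accept_probs[where F = "distinguish HF B M0 M1"] .
      have "1 / ?r ^ (a + b + z) = 1 / ?r ^ a * (1 / ?r ^ b) * (1 / ?r ^ z)"
        by (simp add: power_add)
      also have "\<dots> \<le> \<epsilon>1 \<rho> * \<epsilon>2 \<rho> * real_of_rat (\<zeta> \<rho>)"
        using elim pos by (intro mult_mono) auto
      also have "\<dots> \<le> ?p ?A' REAL * (\<epsilon>2 \<rho> * real_of_rat (\<zeta> \<rho>))"
        unfolding mult.assoc using na' pos by (intro mult_right_mono) auto
      finally have gap: "1 / ?r ^ (a + b + z) \<le> ?p ?A' REAL * (\<epsilon>2 \<rho> * real_of_rat (\<zeta> \<rho>))" .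
      have "?p ?A REAL > ?p ?A' REAL * (1/2 + \<epsilon>2 \<rho> * real_of_rat (\<zeta> \<rho>))"
        using c na' pos by (simp add: less_divide_eq mult.commute)
      then have REAL: "?p ?A REAL > ?p ?A' REAL / 2 + 1 / ?r ^ (a + b + z)"
        using gap by (simp add: distrib_left)
      have LOSSY: "?p ?A LOSSY \<le> ?p ?A' LOSSY / 2 + 5 / 4 * \<epsilon> \<rho>"
        by (rule lossy_distinguish[OF univ B(1,3) inp[THEN spec]])
          (use M \<epsilon>(2) t[THEN spec, of \<rho>] in \<open>auto simp: sampleable_sources_def\<close>)
      have "\<bar>?p ?A REAL - ?p ?A LOSSY\<bar> < 1 / ?r ^ ?k" "\<bar>?p ?A' REAL - ?p ?A' LOSSY\<bar> < 1 / ?r ^ ?k"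
        "\<epsilon> \<rho> < 1 / ?r ^ ?k"
        using elim by (simp_all only: adv_lossy_def abs_abs)
      \<comment> \<open>The constant is \<open>1 + 1/2 + 5/4\<close>: the change of world for the
        distinguisher, half of that for the accepting adversary, and the hashing error.\<close>
      then have "1 / ?r ^ (a + b + z) < 11 / 4 * (1 / ?r ^ ?k)"
        using REAL LOSSY by linarith
      also have "\<dots> \<le> ?r\<^sup>2 * (1 / ?r ^ ?k)"
        using power_mono[OF r, of 2] by (intro mult_right_mono) auto
      also have "\<dots> = 1 / ?r ^ (a + b + z)"
        using r by (simp add: power_add power2_eq_square)
      finally show False by simp
    qed
  qed
qed

lemma adv_priv1_swap: "adv_priv1 pp DE B M1 M0 \<rho> = - adv_priv1 pp DE B M0 M1 \<rho>"
  by (simp add: adv_priv1_def)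

text \<open>The adversary that always outputs \<open>1\<close> satisfies the premise of the third condition for
  \<open>\<zeta> = 1 / 4\<close>, which keeps \<open>\<epsilon>2\<close> below \<open>2\<close>.\<close>

lemma partially_lossy_delta_bound:
  fixes B :: "(tree, 'z) adversary_scheme"
  assumes pl: "partially_lossy sec pp HF LHF P \<omega> \<delta>"
    and B: "ppt_adversary B" "legal sec (gen_pms pp HF) (IdSp HF) B"
  shows "\<forall>\<^sub>F \<rho> in sequentially. \<bar>\<delta> (queries B \<rho>) \<rho>\<bar> \<le> 2"
proof -
  let ?A = "wrap B accept" let ?E = "loss_exp pp HF LHF P \<omega> (\<lambda>_. 1 / 4) ?A REAL"
  obtain \<epsilon>1 \<epsilon>2 where e: "non_negligible_fun \<epsilon>1" "non_negligible_fun \<epsilon>2"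
    and \<delta>: "\<And>\<rho>. \<delta> (queries ?A \<rho>) \<rho> = \<epsilon>1 \<rho> * \<epsilon>2 \<rho>"
    and na: "\<And>\<rho>. measure_pmf.prob (?E \<rho>) {(dA, na). na} \<ge> \<epsilon>1 \<rho>"
    and cond: "\<And>\<rho>. measure_pmf.prob (?E \<rho>) {(dA, na). dA} - 1/2 > real_of_rat (1 / 4) \<Longrightarrow>
      cond_prob (measure_pmf (?E \<rho>)) fst snd - 1/2 > \<epsilon>2 \<rho> * real_of_rat (1 / 4)"
    by (rule partially_lossyE[OF pl ppt_adversary_wrap[OF B(1) ppt_accept] legal_wrap[OF B(2)],
        of "\<lambda>_. 1 / 4"]) (auto intro: non_negligible_const)
  obtain a where a: "\<forall>\<^sub>F \<rho> in sequentially. 1 / real \<rho> ^ a \<le> \<epsilon>1 \<rho>" by (rule non_negligible_funE[OF e(1)])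
  obtain b where b: "\<forall>\<^sub>F \<rho> in sequentially. 1 / real \<rho> ^ b \<le> \<epsilon>2 \<rho>" by (rule non_negligible_funE[OF e(2)])
  show ?thesis
    using a b eventually_gt_at_top[of 0]
  proof eventually_elim
    case (elim \<rho>)
    have "cond_prob (measure_pmf (?E \<rho>)) fst snd \<le> 1"
      unfolding cond_prob_fst_snd by (intro divide_le_eq_1[THEN iffD2]) (auto intro!: measure_pmf.finite_measure_mono simp: zero_less_measure_iff)
    moreover have "cond_prob (measure_pmf (?E \<rho>)) fst snd - 1/2 > \<epsilon>2 \<rho> / 4"
      using cond[of \<rho>] unfolding accept_real[OF B(1)] by (simp add: of_rat_divide)
    ultimately have 2: "\<epsilon>2 \<rho> \<le> 2" by linarith
    have 1: "\<epsilon>1 \<rho> \<le> 1" using na[of \<rho>] measure_pmf.prob_le_1 order.trans by blast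
    have "\<epsilon>1 \<rho> > 0" "\<epsilon>2 \<rho> > 0"
      using elim by (auto intro: less_le_trans[of 0 "1 / real \<rho> ^ _"])
    then show ?case using mult_mono[OF 1 2] \<delta>[of \<rho>] by simp
  qed
qed

lemma hib_de_of_simps [simp]:
  "de_gen_pms pp (hib_de_of HF) = gen_pms pp HF" "de_IdSp (hib_de_of HF) = IdSp HF"
  by (auto simp: de_gen_pms_def gen_pms_def hib_de_of_def)

theorem theorem5:
  fixes sec :: security and pp :: params and HF :: hib_tdf and LHF :: sibling and P :: pre_output
    and \<omega> t \<epsilon> :: "nat \<Rightarrow> real" and \<delta> :: "nat \<Rightarrow> nat \<Rightarrow> real"
  assumes "hib_tdf pp HF"
    and "\<forall>\<rho>. \<forall>pms \<in> set_pmf (gen_pms pp HF \<rho>). InpSp HF pms = bitstrings (inp_len pp \<rho>)"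
    and "partially_lossy sec pp HF LHF P \<omega> \<delta>"
    and "universal sec pp HF LHF \<omega>"
    and "negligible_fun \<epsilon>" and "\<forall>\<rho>. \<epsilon> \<rho> > 0"
    and "\<forall>\<rho>. t \<rho> \<ge> real (inp_len pp \<rho>) - \<omega> \<rho> + 2 * log 2 (1 / \<epsilon> \<rho>)"
  shows "priv1_ind_id_secure sec pp (hib_de_of HF) (sampleable_sources t (inp_len pp))
    \<and> (\<forall>M0 \<in> sampleable_sources t (inp_len pp). \<forall>M1 \<in> sampleable_sources t (inp_len pp).
       \<forall>B. ppt_priv_adversary sec pp (hib_de_of HF) B \<longrightarrow>
        (\<exists>A \<zeta> \<nu>. ppt_adversary A \<and> legal sec (gen_pms pp HF) (IdSp HF) A \<and>
           queries A = queries B \<and> (\<forall>\<rho>. 0 < \<zeta> \<rho> \<and> \<zeta> \<rho> < 1) \<and> negligible_fun \<nu> \<and>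
           (\<forall>\<rho>. adv_lossy pp HF LHF P \<omega> \<zeta> A \<rho> \<ge>
              1/3 * \<delta> (queries B \<rho>) \<rho> * adv_priv1 pp (hib_de_of HF) B M0 M1 \<rho> - \<nu> \<rho>)))"
proof -
  let ?C = "sampleable_sources t (inp_len pp)"
  let ?adv = "adv_priv1 pp (hib_de_of HF)"
  have E: "poly_time (\<lambda>(pms, mpk, u, x). Eval HF pms mpk u x)"
    using assms(1) by (simp add: hib_tdf_def)
  have less: "\<forall>\<^sub>F \<rho> in sequentially. ?adv B M0 M1 \<rho> < 1 / real \<rho> ^ c"
    if "M0 \<in> ?C" "M1 \<in> ?C" "ppt_priv_adversary sec pp (hib_de_of HF) B" for M0 M1 B c
    using that by (intro adv_priv1_eventually_less[OF E assms(2-)]) (auto simp: ppt_priv_adversary_def)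
  have negl: "negligible_fun (?adv B M0 M1)"
    if "M0 \<in> ?C" "M1 \<in> ?C" "ppt_priv_adversary sec pp (hib_de_of HF) B" for M0 M1 B
    unfolding negligible_fun_def
  proof
    fix c
    \<comment> \<open>The bound on the advantage is one-sided; exchanging the two sources supplies
      the bound from below.\<close>
    show "\<forall>\<^sub>F \<rho> in sequentially. \<bar>?adv B M0 M1 \<rho>\<bar> < 1 / real \<rho> ^ c"
      using less[OF that, of c] less[OF that(2,1,3), of c]
      by eventually_elim (auto simp: adv_priv1_swap[of _ _ _ M1 M0])
  qed
  have "\<exists>A \<zeta> \<nu>. ppt_adversary A \<and> legal sec (gen_pms pp HF) (IdSp HF) A \<and>
           queries A = queries B \<and> (\<forall>\<rho>. 0 < \<zeta> \<rho> \<and> \<zeta> \<rho> < 1) \<and> negligible_fun \<nu> \<and>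
           (\<forall>\<rho>. adv_lossy pp HF LHF P \<omega> \<zeta> A \<rho> \<ge>
              1/3 * \<delta> (queries B \<rho>) \<rho> * ?adv B M0 M1 \<rho> - \<nu> \<rho>)"
    if M: "M0 \<in> ?C" "M1 \<in> ?C" and B: "ppt_priv_adversary sec pp (hib_de_of HF) B" for M0 M1 B
  proof -
    have B': "ppt_adversary B" "ppt (guess B)" "legal sec (gen_pms pp HF) (IdSp HF) B"
      using B by (auto simp: ppt_priv_adversary_def)
    let ?A = "wrap B (distinguish HF B M0 M1)"
    define \<nu> where "\<nu> \<rho> = 1/3 * \<delta> (queries B \<rho>) \<rho> * ?adv B M0 M1 \<rho>" for \<rho>
    have "ppt M0" "ppt M1" using M by (auto simp: sampleable_sources_def)
    then have A: "ppt_adversary ?A" by (intro ppt_adversary_wrap B'(1) ppt_distinguish B'(2) E)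
    have "negligible_fun \<nu>"
      unfolding negligible_fun_def
    proof
      fix c
      show "\<forall>\<^sub>F \<rho> in sequentially. \<bar>\<nu> \<rho>\<bar> < 1 / real \<rho> ^ c"
        using partially_lossy_delta_bound[OF assms(3) B'(1,3)] negligible_funD[OF negl[OF that], of c]
      proof eventually_elim
        case (elim \<rho>)
        have "\<bar>\<nu> \<rho>\<bar> = \<bar>\<delta> (queries B \<rho>) \<rho>\<bar> / 3 * \<bar>?adv B M0 M1 \<rho>\<bar>"
          by (simp add: \<nu>_def abs_mult)
        \<comment> \<open>Eventually \<delta> is at most 2 in absolute value, so a third of it is at
          most 1.\<close>
        also have "\<dots> \<le> 1 * \<bar>?adv B M0 M1 \<rho>\<bar>" using elim(1) by (intro mult_right_mono) auto
        finally show ?case using elim(2) by simp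
      qed
    qed
    \<comment> \<open>With this \<nu> the right-hand side is 0, and the left-hand side is an
      absolute value; a constant \<zeta> therefore suffices.\<close>
    moreover have "adv_lossy pp HF LHF P \<omega> (\<lambda>_. 1 / 2) ?A \<rho> \<ge>
        1/3 * \<delta> (queries B \<rho>) \<rho> * ?adv B M0 M1 \<rho> - \<nu> \<rho>" for \<rho>
      by (simp add: \<nu>_def adv_lossy_def)
    ultimately show ?thesis
      using A legal_wrap[OF B'(3)] by (intro exI[of _ ?A] exI[of _ "\<lambda>_. 1 / 2"] exI[of _ \<nu>]) auto
  qed
  with negl show ?thesis unfolding priv1_ind_id_secure_def by blast
qed

end
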